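(* Let $\ell,h_0,\mathtt g>0$ and let $b$ be a smooth function on $[0,\ell]$ such that, with $h_b=h_0-b$, $$\inf_{(0,\ell)} h_b>0\qquad\text{and}\qquad \inf_{(0,\ell)}\Big(1+\tfrac14(\partial_x b)^2+\tfrac16 h_b\,\partial_x^2 b\Big)>0 .$$ Assume that the initial data $(\zeta^{\rm in},q^{\rm in})$ (functions on $(0,\ell)$) and the boundary data $(g_0,g_\ell)$ (functions of time) satisfy the compatibility conditions $$\zeta^{\rm in}(0)=g_0(0),\quad -\partial_xq^{\rm in}(0)=\dot g_0(0),\quad \zeta^{\rm in}(\ell)=g_\ell(0),\quad -\partial_xq^{\rm in}(\ell)=\dot g_\ell(0).$$ Then the two following assertions are equivalent. (i) The couple $(\zeta,q)$ is a regular solution, such that the depth $h=h_0+\zeta-b$ never vanishes, of $$\begin{cases}\partial_t\zeta+\partial_xq=0,\\(1+h_b\mathcal T_b)\partial_tq+\partial_xf_{\rm NSW}=-\mathtt g\,h\,\partial_xb\end{cases}\qquad\text{in }(0,\ell),$$ with boundary conditions $\zeta(\cdot,0)=g_0$, $\zeta(\cdot,\ell)=g_\ell$ and initial condition $(\zeta,q)(0,\cdot)=(\zeta^{\rm in},q^{\rm in})$. (ii) The couple $(\zeta,q)$ is a regular solution, such that the depth $h$ never vanishes, of $$\begin{cases}\partial_t\zeta+\partial_xq=0,\\ \partial_tq+\sqrt3\,\dfrac{h_b}{\alpha_b}(h_bS)^*\Big(R_b^1\big(\tfrac1{h_b^2}f_{\rm NSW}\big)\Big)=R_b^0B+\dot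 q_0\,\mathfrak s^{(b,0)}+\dot q_\ell\,\mathfrak s^{(b,\ell)}\end{cases}\qquad\text{in }(0,\ell),$$ with initial condition $(\zeta,q)(0,\cdot)=(\zeta^{\rm in},q^{\rm in})$, where $q_0$ and $q_\ell$ are functions of time solving the ODE $$\mathfrak S_b'\begin{pmatrix}\dot q_0\\ \dot q_\ell\end{pmatrix}+V_{\rm bdry}(g_0,q_0,g_\ell,q_\ell)=V_{\rm int}[\zeta,q]-\begin{pmatrix}\ddot g_0\\ \ddot g_\ell\end{pmatrix}$$ with initial condition $q_0(0)=q^{\rm in}(0)$ and $q_\ell(0)=q^{\rm in}(\ell)$.
   Context: Constants: $\ell,h_0,\mathtt g>0$. Unknowns $\zeta(t,x)$, $q(t,x)$; $h=h_0+\zeta-b$; $h_b=h_0-b$; $\alpha_b=1+\frac14(\partial_xb)^2$. A dot denotes $\frac{\rm d}{{\rm d}t}$. "Regular solution" means a solution smooth enough for all derivatives and boundary traces involved to make sense classically. Shallow water flux: $f_{\rm NSW}=f_{\rm NSW}(\zeta,q)=\frac12\mathtt g(h^2-h_0^2)+\frac1hq^2$ (at a boundary point $x\in\{0,\ell\}$, $f_{\rm NSW}(\zeta_x,q_x)$ is computed with $h=h_0+\zeta_x-b(x)$). Operators: $\mathcal T_bu=-\frac1{3h_b}\partial_x\big(h_b^3\partial_x\frac u{h_b}\big)+\frac12(\partial_x^2b)u$; $S u=-\frac1{\sqrt3}h_b\partial_x(\frac u{h_b})+\frac{\sqrt3}2\frac{\partial_xb}{h_b}u$; $(h_bS)u=h_b\,Su$;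 $(h_bS)^*$ is the formal $L^2$-adjoint, $(h_bS)^*u=\frac1{\sqrt3}\frac1{h_b}\partial_x(h_b^2u)+\frac{\sqrt3}2(\partial_xb)u$. $R_b^0:f\in L^2(0,\ell)\mapsto u\in H^2(0,\ell)$, where $u$ solves $(1+h_b\mathcal T_b)u=f$, $u(0)=u(\ell)=0$. $R_b^1:f\in L^2(0,\ell)\mapsto u\in H^2(0,\ell)$, where $u$ solves $\big[1+\frac1{h_b}(h_bS)\big(\frac{h_b}{\alpha_b}(h_bS)^*\big)\big]u=f$ with $((h_bS)^*u)(0)=((h_bS)^*u)(\ell)=0$. $\mathfrak s^{(b,0)}$ and $\mathfrak s^{(b,\ell)}$ solve $(1+h_b\mathcal T_b)\mathfrak s=0$ on $(0,\ell)$ with $\mathfrak s^{(b,0)}(0)=1$, $\mathfrak s^{(b,0)}(\ell)=0$ and $\mathfrak s^{(b,\ell)}(0)=0$, $\mathfrak s^{(b,\ell)}(\ell)=1$; and $$\mathfrak S_b'=\begin{pmatrix}(\mathfrak s^{(b,0)})'(0)&(\mathfrak s^{(b,\ell)})'(0)\\(\mathfrak s^{(b,0)})'(\ell)&(\mathfrak s^{(b,\ell)})'(\ell)\end{pmatrix}.$$ Further, $$B=B(\zeta,q)=-\mathtt gh\,\partial_xb+\frac32\frac{\partial_xb}{h_b}f_{\rm NSW},\qquad V_{\rm bdry}(\zeta_0,q_0,\zeta_\ell,q_\ell)=\begin{pmatrix}\frac3{h_b(0)^2}f_{\rm NSW}(\zeta_0,q_0)\\ \frac3{h_b(\ell)^2}f_{\rm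 NSW}(\zeta_\ell,q_\ell)\end{pmatrix},$$ $$V_{\rm int}[\zeta,q]=\begin{pmatrix}3\big(R_b^1(\frac1{h_b^2}f_{\rm NSW})\big)_{|x=0}-\big(\partial_x(R_b^0B)\big)_{|x=0}\\ 3\big(R_b^1(\frac1{h_b^2}f_{\rm NSW})\big)_{|x=\ell}-\big(\partial_x(R_b^0B)\big)_{|x=\ell}\end{pmatrix}.$$ *)

theory Defs
  imports "HOL-Analysis.Analysis"
begin

section \<open>Derivatives and function spaces on a compact interval\<close>

text \<open>Derivative of a function on \<open>[0,a]\<close>, one-sided at the end points; this is how the boundary
  traces of derivatives are read.  Only the values on \<open>[0,a]\<close> matter (for arguments in \<open>[0,a]\<close>).
  It is used both for the space interval \<open>[0,\<ell>]\<close> and for the time interval \<open>[0,T]\<close>.\<close>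

definition D :: "real \<Rightarrow> (real \<Rightarrow> real) \<Rightarrow> real \<Rightarrow> real" where
  "D a f x = vector_derivative f (at x within {0..a})"

definition smooth_upto :: "real \<Rightarrow> (real \<Rightarrow> real) \<Rightarrow> bool" where
  "smooth_upto a f \<longleftrightarrow> (\<forall>n. ((D a) ^^ n) f differentiable_on {0..a})"

text \<open>\<open>H\<^sup>1(0,a)\<close> in dimension one, elements being identified with their continuous
  representative: absolutely continuous functions on \<open>[0,a]\<close> with derivative in \<open>L\<^sup>2\<close>, so that the
  a.e. classical derivative is the weak derivative.  The square-integrability makes the (Henstock)
  integral in the second clause an absolutely convergent Lebesgue integral.\<close>

definition H1 :: "real \<Rightarrow> (real \<Rightarrow> real) \<Rightarrow> bool" where
  "H1 a u \<longleftrightarrow>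
     (AE x\<in>{0<..<a} in lebesgue. u differentiable (at x)) \<and>
     (\<forall>x\<in>{0..a}. (D a u has_integral (u x - u 0)) {0..x}) \<and>
     (\<lambda>x. (D a u x)\<^sup>2) integrable_on {0..a}"

definition H2 :: "real \<Rightarrow> (real \<Rightarrow> real) \<Rightarrow> bool" where
  "H2 a u \<longleftrightarrow> H1 a u \<and> H1 a (D a u)"

section \<open>The operators attached to the bottom\<close>

definition hb :: "real \<Rightarrow> (real \<Rightarrow> real) \<Rightarrow> real \<Rightarrow> real" where
  "hb h0 b x = h0 - b x"

definition alphab :: "real \<Rightarrow> (real \<Rightarrow> real) \<Rightarrow> real \<Rightarrow> real" where
  "alphab l b x = 1 + 1/4 * (D l b x)\<^sup>2"

definition Tb :: "real \<Rightarrow> real \<Rightarrow> (real \<Rightarrow> real) \<Rightarrow> (real \<Rightarrow> real) \<Rightarrow> real \<Rightarrow> real" where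
  "Tb l h0 b u x =
     - 1 / (3 * hb h0 b x) * D l (\<lambda>y. hb h0 b y ^ 3 * D l (\<lambda>z. u z / hb h0 b z) y) x
     + 1/2 * D l (D l b) x * u x"

definition one_plus_hbTb ::
  "real \<Rightarrow> real \<Rightarrow> (real \<Rightarrow> real) \<Rightarrow> (real \<Rightarrow> real) \<Rightarrow> real \<Rightarrow> real" where
  "one_plus_hbTb l h0 b u x = u x + hb h0 b x * Tb l h0 b u x"

definition Sb :: "real \<Rightarrow> real \<Rightarrow> (real \<Rightarrow> real) \<Rightarrow> (real \<Rightarrow> real) \<Rightarrow> real \<Rightarrow> real" where
  "Sb l h0 b u x =
     - 1 / sqrt 3 * hb h0 b x * D l (\<lambda>y. u y / hb h0 b y) x
     + sqrt 3 / 2 * (D l b x / hb h0 b x) * u x"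

definition hbS :: "real \<Rightarrow> real \<Rightarrow> (real \<Rightarrow> real) \<Rightarrow> (real \<Rightarrow> real) \<Rightarrow> real \<Rightarrow> real" where
  "hbS l h0 b u x = hb h0 b x * Sb l h0 b u x"

text \<open>The formal adjoint \<open>(h\<^sub>b S)\<^sup>*\<close>.\<close>

definition hbS_adj :: "real \<Rightarrow> real \<Rightarrow> (real \<Rightarrow> real) \<Rightarrow> (real \<Rightarrow> real) \<Rightarrow> real \<Rightarrow> real" where
  "hbS_adj l h0 b u x =
     1 / sqrt 3 * (1 / hb h0 b x) * D l (\<lambda>y. (hb h0 b y)\<^sup>2 * u y) x
     + sqrt 3 / 2 * D l b x * u x"

text \<open>\<open>u \<in> H\<^sup>2(0,\<ell>)\<close> solves \<open>(1 + h\<^sub>b T\<^sub>b) u = f\<close> with \<open>u(0) = c0\<close>, \<open>u(\<ell>) = cl\<close>.\<close>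

definition dirichlet_sol ::
  "real \<Rightarrow> real \<Rightarrow> (real \<Rightarrow> real) \<Rightarrow> (real \<Rightarrow> real) \<Rightarrow> real \<Rightarrow> real \<Rightarrow> (real \<Rightarrow> real) \<Rightarrow> bool" where
  "dirichlet_sol l h0 b f c0 cl u \<longleftrightarrow>
     H2 l u \<and> (AE x\<in>{0<..<l} in lebesgue. one_plus_hbTb l h0 b u x = f x) \<and>
     u 0 = c0 \<and> u l = cl"

text \<open>\<open>R\<^sub>b\<^sup>0\<close> and \<open>R\<^sub>b\<^sup>1\<close> are meant for \<open>f \<in> L\<^sup>2(0,\<ell>)\<close>.  Where \<open>h\<^sub>b\<close> is smooth and positive, the solutions
  selected below are unique as functions on \<open>[0,\<ell>]\<close>; the choice only concerns the irrelevant
  values outside this interval.\<close>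

definition R0 :: "real \<Rightarrow> real \<Rightarrow> (real \<Rightarrow> real) \<Rightarrow> (real \<Rightarrow> real) \<Rightarrow> real \<Rightarrow> real" where
  "R0 l h0 b f = (SOME u. dirichlet_sol l h0 b f 0 0 u)"

definition R1 :: "real \<Rightarrow> real \<Rightarrow> (real \<Rightarrow> real) \<Rightarrow> (real \<Rightarrow> real) \<Rightarrow> real \<Rightarrow> real" where
  "R1 l h0 b f = (SOME u. H2 l u \<and>
     (AE x\<in>{0<..<l} in lebesgue.
        u x + 1 / hb h0 b x
              * hbS l h0 b (\<lambda>y. hb h0 b y / alphab l b y * hbS_adj l h0 b u y) x = f x) \<and>
     hbS_adj l h0 b u 0 = 0 \<and> hbS_adj l h0 b u l = 0)"

definition s_left :: "real \<Rightarrow> real \<Rightarrow> (real \<Rightarrow> real) \<Rightarrow> real \<Rightarrow> real" where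
  "s_left l h0 b = (SOME s. dirichlet_sol l h0 b (\<lambda>_. 0) 1 0 s)"

definition s_right :: "real \<Rightarrow> real \<Rightarrow> (real \<Rightarrow> real) \<Rightarrow> real \<Rightarrow> real" where
  "s_right l h0 b = (SOME s. dirichlet_sol l h0 b (\<lambda>_. 0) 0 1 s)"

definition S_mat' :: "real \<Rightarrow> real \<Rightarrow> (real \<Rightarrow> real) \<Rightarrow> real^2^2" where
  "S_mat' l h0 b = vector
     [vector [D l (s_left l h0 b) 0, D l (s_right l h0 b) 0],
      vector [D l (s_left l h0 b) l, D l (s_right l h0 b) l]]"

section \<open>Nonlinear terms\<close>

text \<open>The real arguments \<open>z\<close>, \<open>p\<close> are the values of \<open>\<zeta>\<close>, \<open>q\<close> at the point \<open>x\<close>.\<close>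

definition depth :: "real \<Rightarrow> (real \<Rightarrow> real) \<Rightarrow> real \<Rightarrow> real \<Rightarrow> real" where
  "depth h0 b x z = h0 + z - b x"

definition f_NSW :: "real \<Rightarrow> real \<Rightarrow> (real \<Rightarrow> real) \<Rightarrow> real \<Rightarrow> real \<Rightarrow> real \<Rightarrow> real" where
  "f_NSW grav h0 b x z p =
     1/2 * grav * ((depth h0 b x z)\<^sup>2 - h0\<^sup>2) + 1 / depth h0 b x z * p\<^sup>2"

definition B_src :: "real \<Rightarrow> real \<Rightarrow> real \<Rightarrow> (real \<Rightarrow> real) \<Rightarrow> (real \<Rightarrow> real) \<Rightarrow> (real \<Rightarrow> real)
    \<Rightarrow> real \<Rightarrow> real" where
  "B_src l grav h0 b Z Q x =
     - grav * depth h0 b x (Z x) * D l b x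
     + 3/2 * (D l b x / hb h0 b x) * f_NSW grav h0 b x (Z x) (Q x)"

definition V_bdry :: "real \<Rightarrow> real \<Rightarrow> real \<Rightarrow> (real \<Rightarrow> real)
    \<Rightarrow> real \<Rightarrow> real \<Rightarrow> real \<Rightarrow> real \<Rightarrow> real^2" where
  "V_bdry l grav h0 b z0 p0 zl pl = vector
     [3 / (hb h0 b 0)\<^sup>2 * f_NSW grav h0 b 0 z0 p0,
      3 / (hb h0 b l)\<^sup>2 * f_NSW grav h0 b l zl pl]"

text \<open>\<open>R\<^sub>b\<^sup>1 (f\<^sub>N\<^sub>S\<^sub>W / h\<^sub>b\<^sup>2)\<close> for space profiles \<open>Z\<close>, \<open>Q\<close> of \<open>\<zeta>\<close>, \<open>q\<close> at a fixed time.\<close>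

definition R1_flux :: "real \<Rightarrow> real \<Rightarrow> real \<Rightarrow> (real \<Rightarrow> real) \<Rightarrow> (real \<Rightarrow> real) \<Rightarrow> (real \<Rightarrow> real)
    \<Rightarrow> real \<Rightarrow> real" where
  "R1_flux l grav h0 b Z Q =
     R1 l h0 b (\<lambda>x. 1 / (hb h0 b x)\<^sup>2 * f_NSW grav h0 b x (Z x) (Q x))"

definition V_int :: "real \<Rightarrow> real \<Rightarrow> real \<Rightarrow> (real \<Rightarrow> real) \<Rightarrow> (real \<Rightarrow> real) \<Rightarrow> (real \<Rightarrow> real)
    \<Rightarrow> real^2" where
  "V_int l grav h0 b Z Q = vector
     [3 * R1_flux l grav h0 b Z Q 0 - D l (R0 l h0 b (B_src l grav h0 b Z Q)) 0,
      3 * R1_flux l grav h0 b Z Q l - D l (R0 l h0 b (B_src l grav h0 b Z Q)) l]"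

section \<open>Functions of time and space\<close>

definition dt :: "real \<Rightarrow> (real \<Rightarrow> real \<Rightarrow> real) \<Rightarrow> real \<Rightarrow> real \<Rightarrow> real" where
  "dt T u t x = D T (\<lambda>s. u s x) t"

definition dx :: "real \<Rightarrow> (real \<Rightarrow> real \<Rightarrow> real) \<Rightarrow> real \<Rightarrow> real \<Rightarrow> real" where
  "dx l u t x = D l (u t) x"

definition cont :: "real \<Rightarrow> real \<Rightarrow> (real \<Rightarrow> real \<Rightarrow> real) \<Rightarrow> bool" where
  "cont T l u \<longleftrightarrow> continuous_on ({0..T} \<times> {0..l}) (\<lambda>(t, x). u t x)"

definition cont_dt :: "real \<Rightarrow> real \<Rightarrow> (real \<Rightarrow> real \<Rightarrow> real) \<Rightarrow> bool" where
  "cont_dt T l u \<longleftrightarrow>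
     (\<forall>x\<in>{0..l}. (\<lambda>t. u t x) differentiable_on {0..T}) \<and> cont T l (dt T u)"

definition cont_dx :: "real \<Rightarrow> real \<Rightarrow> (real \<Rightarrow> real \<Rightarrow> real) \<Rightarrow> bool" where
  "cont_dx T l u \<longleftrightarrow>
     (\<forall>t\<in>{0..T}. u t differentiable_on {0..l}) \<and> cont T l (dx l u)"

text \<open>Regularity of a couple \<open>(\<zeta>, q)\<close>: the derivatives \<open>\<partial>\<^sub>t\<zeta>\<close>, \<open>\<partial>\<^sub>x\<zeta>\<close>, \<open>\<partial>\<^sub>t\<^sup>2\<zeta>\<close> (whose boundary traces are
  the second derivatives of the boundary data), \<open>\<partial>\<^sub>xq\<close>, \<open>\<partial>\<^sub>tq\<close>, \<open>\<partial>\<^sub>x\<partial>\<^sub>tq\<close> and \<open>\<partial>\<^sub>x\<^sup>2\<partial>\<^sub>tq\<close> (needed in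
  \<open>T\<^sub>b \<partial>\<^sub>tq\<close>) exist classically and are continuous up to the boundary.\<close>

definition regular :: "real \<Rightarrow> real \<Rightarrow> (real \<Rightarrow> real \<Rightarrow> real) \<Rightarrow> (real \<Rightarrow> real \<Rightarrow> real) \<Rightarrow> bool" where
  "regular T l \<zeta> q \<longleftrightarrow>
     cont T l \<zeta> \<and> cont_dt T l \<zeta> \<and> cont_dx T l \<zeta> \<and> cont_dt T l (dt T \<zeta>) \<and>
     cont T l q \<and> cont_dt T l q \<and> cont_dx T l q \<and>
     cont_dx T l (dt T q) \<and> cont_dx T l (dx l (dt T q))"

end

theory Submission
  imports Defs
begin

text \<open>
  Writing \<open>(1 + h\<^sub>b T\<^sub>b) u = F\<close> as \<open>\<alpha>\<^sub>b u + h\<^sub>b (h\<^sub>b S)\<^sup>* ((h\<^sub>b S) u / h\<^sub>b) = F\<close>, one sees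
  that \<open>p = (h\<^sub>b / \<alpha>\<^sub>b) (h\<^sub>b S)\<^sup>* R\<^sub>b\<^sup>1 \<phi>\<close> is the Dirichlet solution with source
  \<open>h\<^sub>b (h\<^sub>b S)\<^sup>* \<phi>\<close>.  For \<open>\<phi> = f\<^sub>N\<^sub>S\<^sub>W / h\<^sub>b\<^sup>2\<close> the source of \<open>sqrt 3 p\<close> is
  \<open>\<partial>\<^sub>x f\<^sub>N\<^sub>S\<^sub>W\<close> up to a term of order zero, so the momentum equation says that
  \<open>\<partial>\<^sub>t q + sqrt 3 p - R\<^sub>b\<^sup>0 B\<close> is in the kernel of \<open>1 + h\<^sub>b T\<^sub>b\<close>, which is spanned by the two
  boundary layers; since \<open>p\<close> and \<open>R\<^sub>b\<^sup>0 B\<close> vanish at the ends, the coefficients are the traces of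
  \<open>\<partial>\<^sub>t q\<close>.  The \<open>x\<close>-derivative at the ends of this decomposition, with
  \<open>\<partial>\<^sub>x \<partial>\<^sub>t q = - \<partial>\<^sub>t\<^sup>2 \<zeta>\<close>, is the boundary ODE with the traces of \<open>\<zeta>\<close> as data.  Conversely,
  comparing this relation with the assumed ODE shows that \<open>\<zeta> - g\<close> at an end solves a second order
  ODE \<open>e'' = O(e)\<close>, and the compatibility conditions are \<open>e(0) = e'(0) = 0\<close>, hence \<open>e = 0\<close>.
\<close>

section \<open>Calculus on a compact interval\<close>

lemma D_eqI:
  assumes "0 < a" "x \<in> {0..a}" "(f has_real_derivative d) (at x within {0..a})"
  shows "D a f x = d"
  unfolding D_def using assms
  by (intro vector_derivative_within_closed_interval)
     (auto simp: has_real_derivative_iff_has_vector_derivative)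

lemma has_derivative_D:
  assumes "f differentiable_on {0..a}" "x \<in> {0..a}"
  shows "(f has_real_derivative D a f x) (at x within {0..a})"
  using assms vector_derivative_works[of f "at x within {0..a}"]
  unfolding D_def differentiable_on_def has_real_derivative_iff_has_vector_derivative by blast

lemma has_derivative_D_at:
  assumes "0 < a" "x \<in> {0<..<a}" "f differentiable at x"
  shows "(f has_real_derivative D a f x) (at x within {0..a})"
proof -
  have "f differentiable (at x within {0..a})"
    using assms(3) differentiable_at_withinI by blast
  then show ?thesis
    using vector_derivative_works[of f "at x within {0..a}"]
    unfolding D_def has_real_derivative_iff_has_vector_derivative by blast
qed

lemma deriv_cong_on:
  assumes "\<And>y. y \<in> S \<Longrightarrow> f y = g y" "x \<in> S"
  shows "(f has_real_derivative d) (at x within S) \<longleftrightarrow> (g has_real_derivative d) (at x within S)"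
  using has_field_derivative_transform_within[where f=f and g=g and a=x and S=S and d=1]
    has_field_derivative_transform_within[where f=g and g=f and a=x and S=S and d=1] assms by auto

lemma D_cong:
  assumes "\<And>y. y \<in> {0..a} \<Longrightarrow> f y = g y" "x \<in> {0..a}"
  shows "D a f x = D a g x"
proof -
  have "(f has_vector_derivative d) (at x within {0..a})
      \<longleftrightarrow> (g has_vector_derivative d) (at x within {0..a})" for d
    using deriv_cong_on[where d=d, OF assms]
    by (simp add: has_real_derivative_iff_has_vector_derivative)
  then show ?thesis by (simp add: D_def vector_derivative_def)
qed

lemma continuous_on_of_deriv:
  assumes "\<And>x. x \<in> S \<Longrightarrow> (f has_real_derivative f' x) (at x within S)"
  shows "continuous_on S f"
  using assms by (meson DERIV_continuous_on)

text \<open>The open interval is dense in the closed one. The equations are posed in the interior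
  only, whereas the argument needs them at the ends, where traces are read.\<close>

lemma eq_on_closed_interval:
  fixes f g :: "real \<Rightarrow> real"
  assumes "0 < a" "continuous_on {0..a} f" "continuous_on {0..a} g"
    and eq: "\<And>x. x \<in> {0<..<a} \<Longrightarrow> f x = g x" and x: "x \<in> {0..a}"
  shows "f x = g x"
proof -
  have cl: "closure {0<..<a} = {0..a}" using assms(1) by simp
  have "\<forall>x\<in>closure {0<..<a}. f x = g x"
  proof
    fix y assume y: "y \<in> closure {0<..<a}"
    have "(\<lambda>x. f x - g x) y = 0"
      by (rule continuous_constant_on_closure[OF _ _ y])
         (use assms cl in \<open>auto intro!: continuous_intros\<close>)
    then show "f y = g y" by simp
  qed
  then show ?thesis using x cl by auto
qed

lemma const_of_zero_deriv:
  assumes "0 < a" "\<And>x. x \<in> {0..a} \<Longrightarrow> (f has_real_derivative 0) (at x within {0..a})" "x \<in> {0..a}"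
  shows "f x = f 0"
proof -
  obtain c where "\<And>y. y \<in> {0..a} \<Longrightarrow> f y = c"
    using has_field_derivative_zero_constant[of "{0..a}" f] assms(2) by auto
  then show ?thesis using assms(1,3) by simp
qed

section \<open>Sobolev functions and classical derivatives\<close>

lemma H1_I:
  assumes a: "0 < a"
    and der: "\<And>x. x \<in> {0..a} \<Longrightarrow> (u has_real_derivative v x) (at x within {0..a})"
    and cont: "continuous_on {0..a} v"
  shows "H1 a u"
proof -
  have Dv: "D a u x = v x" if "x \<in> {0..a}" for x
    using D_eqI[OF a that der[OF that]] .
  have "u differentiable (at x)" if "x \<in> {0<..<a}" for x
  proof -
    have "(u has_real_derivative v x) (at x within {0..a})" using that der by auto
    then have "(u has_real_derivative v x) (at x)"
      using that by (simp add: at_within_Icc_at)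
    then show ?thesis using real_differentiable_def by blast
  qed
  then have "AE x\<in>{0<..<a} in lebesgue. u differentiable (at x)" by (intro AE_I2 impI)
  moreover have "(D a u has_integral (u x - u 0)) {0..x}" if x: "x \<in> {0..a}" for x
  proof -
    have "(v has_integral (u x - u 0)) {0..x}"
    proof (rule fundamental_theorem_of_calculus)
      show "(u has_vector_derivative v y) (at y within {0..x})" if "y \<in> {0..x}" for y
        using DERIV_subset[OF der[of y], of "{0..x}"] that x
        unfolding has_real_derivative_iff_has_vector_derivative by auto
    qed (use x in auto)
    then show ?thesis
      by (rule has_integral_eq[rotated]) (use Dv x in simp)
  qed
  moreover have "(\<lambda>x. (D a u x)\<^sup>2) integrable_on {0..a}"
  proof -
    have "continuous_on {0..a} (\<lambda>x. (D a u x)\<^sup>2)"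
      using continuous_on_eq[OF continuous_on_power[OF cont, of 2]] Dv by simp
    then show ?thesis by (rule integrable_continuous_real)
  qed
  ultimately show ?thesis unfolding H1_def by blast
qed

lemma H2_I:
  assumes a: "0 < a"
    and d1: "\<And>x. x \<in> {0..a} \<Longrightarrow> (u has_real_derivative v x) (at x within {0..a})"
    and d2: "\<And>x. x \<in> {0..a} \<Longrightarrow> (v has_real_derivative w x) (at x within {0..a})"
    and cont: "continuous_on {0..a} w"
  shows "H2 a u"
proof -
  have "continuous_on {0..a} v" by (rule continuous_on_of_deriv[OF d2])
  with a d1 have "H1 a u" by (rule H1_I)
  moreover have "H1 a (D a u)"
  proof (rule H1_I[OF a _ cont])
    fix x assume x: "x \<in> {0..a}"
    have "D a u y = v y" if "y \<in> {0..a}" for y using D_eqI[OF a that d1[OF that]] .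
    then show "(D a u has_real_derivative w x) (at x within {0..a})"
      using deriv_cong_on[of "{0..a}" "D a u" v x "w x"] x d2[OF x] by blast
  qed
  ultimately show ?thesis unfolding H2_def by blast
qed

text \<open>Changing the integrand on a null set does not affect
  \<open>w y = w 0 + integral {0..y} m\<close>, and the integral of a continuous function is
  differentiable everywhere, ends included. This turns equations valid almost everywhere into
  classical ones.\<close>

lemma H1_classical:
  assumes a: "0 < a" and H: "H1 a w" and cont: "continuous_on {0..a} m"
    and ae: "AE x\<in>{0<..<a} in lebesgue. D a w x = m x"
    and x: "x \<in> {0..a}"
  shows "(w has_real_derivative m x) (at x within {0..a})"
proof -
  obtain N where N: "N \<in> null_sets lebesgue" "{x. \<not> (x \<in> {0<..<a} \<longrightarrow> D a w x = m x)} \<subseteq> N"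
    using ae by (auto simp: eventually_ae_filter)
  \<comment> \<open>The almost-everywhere identity concerns the open interval only, so both end
    points join the exceptional set.\<close>
  define N' where "N' = N \<union> {0, a}"
  have neg: "negligible N'"
    unfolding N'_def using N(1) negligible_iff_null_sets[of N]
    by (metis negligible_Un negligible_finite finite.intros)
  have *: "w y = w 0 + integral {0..y} m" if y: "y \<in> {0..a}" for y
  proof -
    have I: "(D a w has_integral (w y - w 0)) {0..y}" using H y unfolding H1_def by blast
    have "(m has_integral (w y - w 0)) {0..y}"
    proof (rule has_integral_spike[OF neg _ I])
      fix z assume z: "z \<in> {0..y} - N'"
      then have "z \<in> {0<..<a}" using y unfolding N'_def by auto
      then show "m z = D a w z" using z N(2) unfolding N'_def by auto
    qed
    then show ?thesis by (simp add: integral_unique)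
  qed
  have "((\<lambda>y. integral {0..y} m) has_real_derivative m x) (at x within {0..a})"
    using integral_has_vector_derivative[OF cont x]
    by (simp add: has_real_derivative_iff_has_vector_derivative)
  then have "((\<lambda>y. w 0 + integral {0..y} m) has_real_derivative 0 + m x) (at x within {0..a})"
    by (intro derivative_intros)
  then show ?thesis using deriv_cong_on[of "{0..a}" w, OF * x] by simp
qed

lemma H1_continuous_on:
  assumes H: "H1 a w"
  shows "continuous_on {0..a} w"
proof (cases "a \<ge> 0")
  case True
  then have "(D a w has_integral (w a - w 0)) {0..a}" using H unfolding H1_def by auto
  then have "D a w integrable_on {0..a}" by blast
  then have "continuous_on {0..a} (\<lambda>y. w 0 + integral {0..y} (D a w))"
    by (intro continuous_intros indefinite_integral_continuous_1)
  moreover have "w 0 + integral {0..y} (D a w) = w y" if "y \<in> {0..a}" for y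
  proof -
    have "(D a w has_integral (w y - w 0)) {0..y}" using H that unfolding H1_def by blast
    then show ?thesis by (simp add: integral_unique)
  qed
  ultimately show ?thesis by (rule continuous_on_eq)
qed auto

text \<open>\<open>D a u\<close> is itself in \<open>H1\<close>, hence continuous, and can be taken
  as the function \<open>m\<close> of \<open>H1_classical\<close>.\<close>

lemma H2_deriv:
  assumes "0 < a" "H2 a u" "x \<in> {0..a}"
  shows "(u has_real_derivative D a u x) (at x within {0..a})"
proof -
  have H: "H1 a u" "H1 a (D a u)" using assms(2) unfolding H2_def by auto
  show ?thesis
    by (rule H1_classical[OF assms(1) H(1) H1_continuous_on[OF H(2)] _ assms(3)]) simp
qed

lemma H2_deriv2_ae:
  assumes a: "0 < a" and H: "H2 a u"
  shows "AE x\<in>{0<..<a} in lebesgue.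
    (D a u has_real_derivative D a (D a u) x) (at x within {0..a})"
proof -
  have "AE x\<in>{0<..<a} in lebesgue. D a u differentiable (at x)"
    using H unfolding H2_def H1_def by blast
  then show ?thesis
    by (rule eventually_mono) (use has_derivative_D_at[OF a] in blast)
qed

section \<open>Uniqueness and existence for ordinary differential equations\<close>

text \<open>Picard iteration for U'' = k U + c, written as a series: \<open>e 0\<close> solves the
  problem with k = 0 and carries the initial data, and each further term is the double integral of
  \<open>k\<close> times the previous one. Factorial decay gives uniform convergence, which
  justifies differentiating term by term, twice.\<close>

lemma linear_ode_ivp_exists:
  fixes k c :: "real \<Rightarrow> real"
  assumes a: "0 \<le> a" and k: "continuous_on {0..a} k" and c: "continuous_on {0..a} c"
  obtains U U1 where
    "U 0 = u0" "U1 0 = u1"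
    "\<And>x. x \<in> {0..a} \<Longrightarrow> (U has_real_derivative U1 x) (at x within {0..a})"
    "\<And>x. x \<in> {0..a} \<Longrightarrow> (U1 has_real_derivative k x * U x + c x) (at x within {0..a})"
proof -
  define J where "J f x = integral {0..x} f" for f :: "real \<Rightarrow> real" and x
  have J0: "J f 0 = 0" for f unfolding J_def by simp
  have dJ: "(J f has_real_derivative f x) (at x within {0..a})"
    if "continuous_on {0..a} f" "x \<in> {0..a}" for f x
    using integral_has_vector_derivative[OF that] unfolding J_def
    by (simp add: has_real_derivative_iff_has_vector_derivative)
  have cJ: "continuous_on {0..a} (J f)" if "continuous_on {0..a} f" for f
    by (rule continuous_on_of_deriv) (use dJ that in auto)
  define z1 where "z1 x = u1 + J c x" for x
  define z where "z x = u0 + J z1 x" for x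
  have cz1: "continuous_on {0..a} z1"
    unfolding z1_def using cJ[OF c] by (auto intro!: continuous_intros)
  have cz: "continuous_on {0..a} z"
    unfolding z_def using cJ[OF cz1] by (auto intro!: continuous_intros)
  have dz1: "(z1 has_real_derivative c x) (at x within {0..a})" if "x \<in> {0..a}" for x
    unfolding z1_def using dJ[OF c that] by (auto intro!: derivative_eq_intros)
  have dz: "(z has_real_derivative z1 x) (at x within {0..a})" if "x \<in> {0..a}" for x
    unfolding z_def using dJ[OF cz1 that] by (auto intro!: derivative_eq_intros)
  define e where "e = rec_nat z (\<lambda>_ f. J (J (\<lambda>s. k s * f s)))"
  have e0: "e 0 = z" and eS: "e (Suc n) = J (J (\<lambda>s. k s * e n s))" for n
    unfolding e_def by simp_all
  define d where "d n = J (\<lambda>s. k s * e n s)" for n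
  have ce: "continuous_on {0..a} (e n)" for n
  proof (induction n)
    case 0 show ?case using cz e0 by simp
  next
    case (Suc n)
    show ?case unfolding eS by (intro cJ continuous_intros k Suc)
  qed
  have cke: "continuous_on {0..a} (\<lambda>s. k s * e n s)" for n
    by (intro continuous_intros k ce)
  have cd: "continuous_on {0..a} (d n)" for n unfolding d_def by (rule cJ[OF cke])
  have dd: "(d n has_real_derivative k x * e n x) (at x within {0..a})" if "x \<in> {0..a}" for n x
    unfolding d_def by (rule dJ[OF cke that])
  have de: "(e (Suc n) has_real_derivative d n x) (at x within {0..a})" if "x \<in> {0..a}" for n x
    using dJ[OF cd that, of n] unfolding eS d_def .
  obtain K where K: "\<And>x. x \<in> {0..a} \<Longrightarrow> \<bar>k x\<bar> \<le> K" "0 \<le> K"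
  proof -
    have "bounded (k ` {0..a})" by (intro compact_imp_bounded compact_continuous_image k) simp
    then obtain K where "\<forall>x\<in>{0..a}. \<bar>k x\<bar> \<le> K" by (auto simp: bounded_iff)
    then show ?thesis using that[of "max K 0"] by (auto simp: le_max_iff_disj)
  qed
  obtain A where A: "\<And>x. x \<in> {0..a} \<Longrightarrow> \<bar>z x\<bar> \<le> A" "0 \<le> A"
  proof -
    have "bounded (z ` {0..a})" by (intro compact_imp_bounded compact_continuous_image cz) simp
    then obtain K where "\<forall>x\<in>{0..a}. \<bar>z x\<bar> \<le> K" by (auto simp: bounded_iff)
    then show ?thesis using that[of "max K 0"] by (auto simp: le_max_iff_disj)
  qed
  \<comment> \<open>Majorant of \<open>e n\<close>. Of the two integrations in one iteration, the
    first is bounded crudely by the factor \<open>a\<close>, and the second raises the power of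
    \<open>x\<close> and produces the factorial.\<close>
  define p where "p n x = A * (K * a * x) ^ n / fact n" for n and x :: real
  have p_mono: "p n x \<le> p n y" if "0 \<le> x" "x \<le> y" for n x y
    unfolding p_def using that A(2) K(2) a
    by (intro divide_right_mono mult_left_mono power_mono mult_nonneg_nonneg) auto
  have p_nonneg: "0 \<le> p n x" if "0 \<le> x" for n x
    unfolding p_def using that A(2) K(2) a by auto
  have d_bd: "\<bar>d n y\<bar> \<le> K * a * p n y"
    if H: "\<And>s. s \<in> {0..a} \<Longrightarrow> \<bar>e n s\<bar> \<le> p n s" and y: "y \<in> {0..a}" for n y
  proof -
    have "norm (integral {0..y} (\<lambda>s. k s * e n s)) \<le> integral {0..y} (\<lambda>s. K * p n y)"
    proof (rule integral_norm_bound_integral)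
      show "(\<lambda>s. k s * e n s) integrable_on {0..y}"
        by (rule integrable_continuous_real, rule continuous_on_subset[OF cke]) (use y in auto)
      fix s assume s: "s \<in> {0..y}"
      have "\<bar>k s\<bar> * \<bar>e n s\<bar> \<le> K * p n y"
        using s y K H[of s] p_mono[of s y n] by (intro mult_mono) force+
      then show "norm (k s * e n s) \<le> K * p n y" by (simp add: abs_mult)
    qed auto
    also have "\<dots> = y * (K * p n y)" using y by simp
    also have "\<dots> \<le> a * (K * p n y)"
      using y K(2) p_nonneg[of y n] by (intro mult_right_mono mult_nonneg_nonneg) auto
    finally show ?thesis unfolding d_def J_def by (simp add: mult_ac)
  qed
  have e_bd: "\<bar>e n x\<bar> \<le> p n x" if "x \<in> {0..a}" for n x
    using that
  proof (induction n arbitrary: x)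
    case 0 then show ?case using A e0 by (simp add: p_def)
  next
    case (Suc n)
    have FTC: "((\<lambda>y. K * a * p n y) has_integral (p (Suc n) x - p (Suc n) 0)) {0..x}"
    proof (rule fundamental_theorem_of_calculus)
      show "(p (Suc n) has_vector_derivative K * a * p n y) (at y within {0..x})" for y
      proof -
        have "(p (Suc n) has_real_derivative K * a * p n y) (at y within {0..x})"
          unfolding p_def
          by (rule derivative_eq_intros refl | simp)+
        then show ?thesis by (simp add: has_real_derivative_iff_has_vector_derivative)
      qed
    qed (use Suc in auto)
    have "norm (integral {0..x} (d n)) \<le> integral {0..x} (\<lambda>y. K * a * p n y)"
    proof (rule integral_norm_bound_integral)
      show "d n integrable_on {0..x}"
        by (rule integrable_continuous_real, rule continuous_on_subset[OF cd]) (use Suc in auto)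
      show "(\<lambda>y. K * a * p n y) integrable_on {0..x}" using FTC by blast
      show "norm (d n y) \<le> K * a * p n y" if "y \<in> {0..x}" for y
        using d_bd[of n y] Suc that by auto
    qed
    also have "\<dots> = p (Suc n) x" using integral_unique[OF FTC] by (simp only:) (simp add: p_def)
    finally show ?case unfolding eS by (simp add: d_def J_def)
  qed
  have sum_p: "summable (\<lambda>n. p n a)"
  proof -
    have "summable (\<lambda>n. A * (inverse (fact n) * (K * a * a) ^ n))"
      by (intro summable_mult summable_exp)
    then show ?thesis by (simp add: p_def divide_simps mult_ac)
  qed
  have unif_ke: "uniform_limit {0..a} (\<lambda>n x. \<Sum>i<n. k x * e i x) (\<lambda>x. \<Sum>i. k x * e i x) sequentially"
  proof (rule Weierstrass_m_test[where M = "\<lambda>n. K * p n a"])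
    fix n x assume x: "x \<in> {0..a}"
    have "\<bar>k x\<bar> * \<bar>e n x\<bar> \<le> K * p n a"
      using x K e_bd[OF x, of n] p_mono[of x a n] by (intro mult_mono) force+
    then show "norm (k x * e n x) \<le> K * p n a" by (simp add: abs_mult)
  qed (use sum_p in \<open>auto intro: summable_mult\<close>)
  have unif_d: "uniform_limit {0..a} (\<lambda>n x. \<Sum>i<n. d i x) (\<lambda>x. \<Sum>i. d i x) sequentially"
  proof (rule Weierstrass_m_test[where M = "\<lambda>n. K * a * p n a"])
    fix n x assume x: "x \<in> {0..a}"
    have "\<bar>d n x\<bar> \<le> K * a * p n x" using d_bd e_bd x by blast
    also have "\<dots> \<le> K * a * p n a" using x K a p_mono[of x a n] by (intro mult_left_mono) auto
    finally show "norm (d n x) \<le> K * a * p n a" by simp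
  qed (use sum_p in \<open>auto intro: summable_mult\<close>)
  have sum_e: "summable (\<lambda>n. e n x)" if "x \<in> {0..a}" for x
    by (rule summable_comparison_test'[OF sum_p, of 0])
       (use e_bd[OF that] p_mono[of x a] that in \<open>force intro: order_trans\<close>)
  have "\<exists>g. \<forall>x\<in>{0..a}. (\<lambda>n. d n x) sums g x \<and>
      (g has_real_derivative (\<Sum>i. k x * e i x)) (at x within {0..a})"
    by (rule has_field_derivative_series[OF _ dd unif_ke, where ?x0.0=0])
       (use a in \<open>auto simp: d_def J0\<close>)
  then obtain H where H: "\<And>x. x \<in> {0..a} \<Longrightarrow> (\<lambda>n. d n x) sums H x"
    "\<And>x. x \<in> {0..a} \<Longrightarrow> (H has_real_derivative (\<Sum>i. k x * e i x)) (at x within {0..a})" by blast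
  \<comment> \<open>The shift of index leaves out \<open>e 0 = z\<close>, whose derivative is
    \<open>z1\<close> and not one of the \<open>d n\<close>. The solution is therefore
    \<open>z + G\<close>, with derivative \<open>z1 + H\<close>.\<close>
  have "\<exists>g. \<forall>x\<in>{0..a}. (\<lambda>n. e (Suc n) x) sums g x \<and>
      (g has_real_derivative (\<Sum>i. d i x)) (at x within {0..a})"
    by (rule has_field_derivative_series[OF _ de unif_d, where ?x0.0=0])
       (use a in \<open>auto simp: eS J0\<close>)
  then obtain G where G: "\<And>x. x \<in> {0..a} \<Longrightarrow> (\<lambda>n. e (Suc n) x) sums G x"
    "\<And>x. x \<in> {0..a} \<Longrightarrow> (G has_real_derivative (\<Sum>i. d i x)) (at x within {0..a})" by blast
  have sumd: "(\<Sum>i. d i x) = H x" if "x \<in> {0..a}" for x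
    using H(1)[OF that] by (simp add: sums_iff)
  have sume: "(\<Sum>i. k x * e i x) = k x * (z x + G x)" if "x \<in> {0..a}" for x
  proof -
    have "(\<Sum>i. e i x) = z x + G x"
      using G(1)[OF that] suminf_split_head[OF sum_e[OF that]] e0 by (simp add: sums_iff)
    then show ?thesis using suminf_mult[OF sum_e[OF that]] by simp
  qed
  have "G 0 = 0" using G(1)[of 0] a by (simp add: eS J0 sums_iff)
  moreover have "H 0 = 0" using H(1)[of 0] a by (simp add: d_def J0 sums_iff)
  ultimately show ?thesis
  proof (intro that[of "\<lambda>x. z x + G x" "\<lambda>x. z1 x + H x"])
    fix x assume x: "x \<in> {0..a}"
    show "((\<lambda>x. z x + G x) has_real_derivative z1 x + H x) (at x within {0..a})"
      using G(2)[OF x] dz[OF x] sumd[OF x] by (auto intro!: derivative_eq_intros)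
    show "((\<lambda>x. z1 x + H x) has_real_derivative k x * (z x + G x) + c x) (at x within {0..a})"
      using H(2)[OF x] dz1[OF x] sume[OF x] by (auto intro!: derivative_eq_intros)
  qed (simp_all add: z_def z1_def J0)
qed

section \<open>Monotonicity and uniqueness for a second order differential inequality\<close>

lemma le_of_nonneg_deriv:
  fixes f :: "real \<Rightarrow> real"
  assumes ab: "a \<le> b"
    and der: "\<And>x. x \<in> {a..b} \<Longrightarrow> (f has_real_derivative f' x) (at x within {a..b})"
    and nonneg: "\<And>x. x \<in> {a..b} \<Longrightarrow> 0 \<le> f' x"
  shows "f a \<le> f b"
proof -
  have "\<exists>x\<in>{a..b}. f b - f a = (*) (f' x) (b - a)"
    using der by (intro mvt_very_simple[OF ab]) (auto simp: has_field_derivative_def)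
  then obtain x where "x \<in> {a..b}" "f b - f a = f' x * (b - a)" by auto
  moreover have "0 \<le> f' x * (b - a)" using ab nonneg[OF calculation(1)] by simp
  ultimately show ?thesis by linarith
qed

text \<open>At the last zero of the energy \<open>e\<^sup>2 + e'\<^sup>2\<close> before a positive value, the deviation is
  still small on a short interval, and Gronwall's argument applies there.\<close>

lemma second_order_local_uniqueness:
  fixes e e1 e2 :: "real \<Rightarrow> real"
  assumes d1: "\<And>t. t \<in> {0..T} \<Longrightarrow> (e has_real_derivative e1 t) (at t within {0..T})"
    and d2: "\<And>t. t \<in> {0..T} \<Longrightarrow> (e1 has_real_derivative e2 t) (at t within {0..T})"
    and init: "e 0 = 0" "e1 0 = 0" and eps: "0 < \<epsilon>"
    and bd: "\<And>t. t \<in> {0..T} \<Longrightarrow> \<bar>e t\<bar> \<le> \<epsilon> \<Longrightarrow> \<bar>e2 t\<bar> \<le> C * \<bar>e t\<bar>"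
    and t: "t \<in> {0..T}"
  shows "e t = 0"
proof (rule ccontr)
  assume nz: "e t \<noteq> 0"
  have ce: "continuous_on {0..T} e" by (rule continuous_on_of_deriv[OF d1])
  have ce1: "continuous_on {0..T} e1" by (rule continuous_on_of_deriv[OF d2])
  define E where "E t = (e t)\<^sup>2 + (e1 t)\<^sup>2" for t
  have cE: "continuous_on {0..T} E" unfolding E_def by (intro continuous_intros ce ce1)
  define Z where "Z = {s \<in> {0..t}. E s = 0}"
  have "closed Z"
  proof -
    have "closed ({0..t} \<inter> E -` {0})"
      by (rule continuous_closed_preimage) (use t in \<open>auto intro: continuous_on_subset[OF cE]\<close>)
    moreover have "Z = {0..t} \<inter> E -` {0}" unfolding Z_def by auto
    ultimately show ?thesis by simp
  qed
  have Zne: "0 \<in> Z" unfolding Z_def E_def using init t by auto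
  have bZ: "bdd_above Z" unfolding Z_def by auto
  define s where "s = Sup Z"
  have sZ: "s \<in> Z" unfolding s_def
    using closed_contains_Sup[OF _ bZ \<open>closed Z\<close>] Zne by blast
  then have s: "0 \<le> s" "s \<le> t" "E s = 0" unfolding Z_def by auto
  have "s \<noteq> t" using s(3) nz unfolding E_def by (auto simp: sum_power2_eq_zero_iff)
  then have st: "s < t" using s by simp
  have es: "e s = 0" using s(3) unfolding E_def by (simp add: sum_power2_eq_zero_iff)
  have sT: "s \<in> {0..T}" using s t by auto
  obtain \<delta> where \<delta>: "\<delta> > 0" "\<And>r. r \<in> {0..T} \<Longrightarrow> dist r s < \<delta> \<Longrightarrow> dist (e r) (e s) < \<epsilon>"
    using ce sT eps unfolding continuous_on_iff by metis
  define r where "r = min t (s + \<delta> / 2)"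
  have r: "s < r" "r \<le> t" "r < s + \<delta>" unfolding r_def using st \<delta>(1) by auto
  have small: "\<bar>e x\<bar> \<le> \<epsilon>" if "x \<in> {s..r}" for x
    using \<delta>(2)[of x] that r s t es by (auto simp: dist_real_def)
  \<comment> \<open>The rate comes from E' = 2 e e1 + 2 e1 e2 and the bounds 2 |e| |e1| \<le> E and
    |e2| \<le> |C| |e|: together they give E' \<le> (1 + |C|) E, so that the weighted energy is
    nonincreasing.\<close>
  define W where "W x = E x * exp (- (1 + \<bar>C\<bar>) * x)" for x
  have dW: "(W has_real_derivative
      (2 * e x * e1 x + 2 * e1 x * e2 x - (1 + \<bar>C\<bar>) * E x) * exp (- (1 + \<bar>C\<bar>) * x)) (at x within {s..r})"
    if x: "x \<in> {s..r}" for x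
  proof -
    have xT: "x \<in> {0..T}" and sub: "{s..r} \<subseteq> {0..T}" using x s r t by auto
    note D1 = DERIV_subset[OF d1[OF xT] sub] and D2 = DERIV_subset[OF d2[OF xT] sub]
    show ?thesis unfolding W_def E_def
      by (rule derivative_eq_intros D1 D2 refl | simp)+ (simp add: algebra_simps power2_eq_square)
  qed
  have neg: "(2 * e x * e1 x + 2 * e1 x * e2 x - (1 + \<bar>C\<bar>) * E x) * exp (- (1 + \<bar>C\<bar>) * x) \<le> 0"
    if x: "x \<in> {s..r}" for x
  proof -
    have xT: "x \<in> {0..T}" using x s r t by auto
    have "\<bar>e2 x\<bar> \<le> \<bar>C\<bar> * \<bar>e x\<bar>"
      using bd[OF xT small[OF x]] by (meson abs_ge_self abs_ge_zero mult_right_mono order_trans)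
    then have "\<bar>e1 x\<bar> * \<bar>e2 x\<bar> \<le> \<bar>e1 x\<bar> * (\<bar>C\<bar> * \<bar>e x\<bar>)" by (simp add: mult_left_mono)
    moreover have "e1 x * e2 x \<le> \<bar>e1 x\<bar> * \<bar>e2 x\<bar>" by (metis abs_ge_self abs_mult)
    ultimately have 1: "2 * e1 x * e2 x \<le> \<bar>C\<bar> * (2 * \<bar>e x\<bar> * \<bar>e1 x\<bar>)" by (simp add: mult_ac)
    have 2: "2 * \<bar>e x\<bar> * \<bar>e1 x\<bar> \<le> E x"
      using sum_squares_bound[of "\<bar>e x\<bar>" "\<bar>e1 x\<bar>"] unfolding E_def by simp
    have "2 * e x * e1 x \<le> 2 * \<bar>e x\<bar> * \<bar>e1 x\<bar>" by (metis abs_ge_self abs_mult mult.assoc abs_numeral)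
    with 2 have 3: "2 * e x * e1 x \<le> E x" by linarith
    have "\<bar>C\<bar> * (2 * \<bar>e x\<bar> * \<bar>e1 x\<bar>) \<le> \<bar>C\<bar> * E x" using 2 by (simp add: mult_left_mono)
    with 1 3 have "2 * e x * e1 x + 2 * e1 x * e2 x - (1 + \<bar>C\<bar>) * E x \<le> 0"
      by (simp add: algebra_simps)
    then show ?thesis by (simp add: mult_nonpos_nonneg)
  qed
  have "- W s \<le> - W r"
  proof (rule le_of_nonneg_deriv[of s r "\<lambda>x. - W x"])
    show "((\<lambda>x. - W x) has_real_derivative
        - ((2 * e x * e1 x + 2 * e1 x * e2 x - (1 + \<bar>C\<bar>) * E x) * exp (- (1 + \<bar>C\<bar>) * x)))
        (at x within {s..r})" if "x \<in> {s..r}" for x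
      by (rule DERIV_minus[OF dW[OF that]])
  qed (use r neg in \<open>auto simp: neg_le_0_iff_le\<close>)
  then have "W r \<le> W s" by simp
  \<comment> \<open>The energy is zero at \<open>s\<close> and cannot become positive, so
    \<open>r\<close> is a zero lying beyond the supremum of all zeros.\<close>
  then have "E r \<le> 0" using s(3) unfolding W_def by (simp add: mult_le_0_iff)
  then have "E r = 0" unfolding E_def by (smt (verit) zero_le_power2)
  then have "r \<in> Z" unfolding Z_def using r s by auto
  then have "r \<le> s" unfolding s_def using bZ by (simp add: cSup_upper)
  then show False using r by simp
qed

section \<open>The operators as first order systems\<close>

text \<open>Positivity on the closed interval keeps every quotient continuous up to the ends.
  Differentiability of the second derivative of \<open>b\<close> serves to make
  \<open>\<gamma>\<close> continuous.\<close>

locale bottom =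
  fixes l h0 :: real and b :: "real \<Rightarrow> real"
  assumes l_pos: "0 < l"
    and b_diff: "b differentiable_on {0..l}"
    and b_diff': "D l b differentiable_on {0..l}"
    and b_diff'': "D l (D l b) differentiable_on {0..l}"
    and hb_pos: "\<And>x. x \<in> {0..l} \<Longrightarrow> 0 < hb h0 b x"
begin

abbreviation \<eta> where "\<eta> \<equiv> hb h0 b"
abbreviation \<beta> where "\<beta> \<equiv> D l b"
abbreviation \<gamma> where "\<gamma> \<equiv> D l (D l b)"
abbreviation \<alpha> where "\<alpha> \<equiv> alphab l b"

abbreviation deriv_on :: "(real \<Rightarrow> real) \<Rightarrow> real \<Rightarrow> real \<Rightarrow> bool"
  where "deriv_on f d x \<equiv> (f has_real_derivative d) (at x within {0..l})"

lemma eta_nz: "x \<in> {0..l} \<Longrightarrow> \<eta> x \<noteq> 0"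
  using hb_pos by force

lemma alpha_ge1: "1 \<le> \<alpha> x"
  by (simp add: alphab_def)

lemma alpha_nz [simp]: "\<alpha> x \<noteq> 0"
  using alpha_ge1[of x] by linarith

lemma d_eta: "x \<in> {0..l} \<Longrightarrow> deriv_on \<eta> (- \<beta> x) x"
  unfolding hb_def using has_derivative_D[OF b_diff]
  by (auto intro!: derivative_eq_intros)

lemma d_beta: "x \<in> {0..l} \<Longrightarrow> deriv_on \<beta> (\<gamma> x) x"
  by (rule has_derivative_D[OF b_diff'])

lemma d_alpha: "x \<in> {0..l} \<Longrightarrow> deriv_on \<alpha> (\<beta> x * \<gamma> x / 2) x"
  unfolding alphab_def by (rule derivative_eq_intros d_beta refl | simp)+

lemma c_eta: "continuous_on {0..l} \<eta>" and c_beta: "continuous_on {0..l} \<beta>"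
  and c_alpha: "continuous_on {0..l} \<alpha>" and c_gamma: "continuous_on {0..l} \<gamma>"
  using continuous_on_of_deriv[OF d_eta] continuous_on_of_deriv[OF d_beta]
    continuous_on_of_deriv[OF d_alpha] differentiable_imp_continuous_on[OF b_diff''] by auto

lemmas cont_bottom = c_eta c_beta c_alpha c_gamma

text \<open>The flux \<open>M = \<eta> u' - \<beta> u / 2\<close> is \<open>- sqrt 3\<close> times \<open>(h\<^sub>b S) u\<close>.  In these variables
  \<open>1 + h\<^sub>b T\<^sub>b = \<alpha>\<^sub>b + h\<^sub>b (h\<^sub>b S)\<^sup>* (1 / h\<^sub>b) (h\<^sub>b S)\<close> becomes a first order system whose
  coefficients do not involve second derivatives of the bottom.\<close>

definition flux_system :: "(real \<Rightarrow> real) \<Rightarrow> (real \<Rightarrow> real) \<Rightarrow> (real \<Rightarrow> real) \<Rightarrow> bool" where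
  "flux_system F u M \<longleftrightarrow> (\<forall>x\<in>{0..l}.
     deriv_on u ((M x + \<beta> x * u x / 2) / \<eta> x) x \<and>
     deriv_on M ((3 * \<alpha> x * u x - \<beta> x * M x / 2 - 3 * F x) / \<eta> x) x)"

lemma flux_system_u: "flux_system F u M \<Longrightarrow> x \<in> {0..l} \<Longrightarrow>
    deriv_on u ((M x + \<beta> x * u x / 2) / \<eta> x) x"
  and flux_system_M: "flux_system F u M \<Longrightarrow> x \<in> {0..l} \<Longrightarrow>
    deriv_on M ((3 * \<alpha> x * u x - \<beta> x * M x / 2 - 3 * F x) / \<eta> x) x"
  by (auto simp: flux_system_def)

lemma flux_system_cont:
  assumes "flux_system F u M"
  shows "continuous_on {0..l} u" "continuous_on {0..l} M"
  by (rule continuous_on_of_deriv, rule flux_system_u[OF assms], assumption)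
     (rule continuous_on_of_deriv, rule flux_system_M[OF assms], assumption)

text \<open>Superposition. It is used to adjust a boundary value by shooting, to subtract two
  solutions, and to assemble the boundary layer decomposition.\<close>

lemma flux_system_lin:
  assumes "flux_system F u M" "flux_system G v N"
  shows "flux_system (\<lambda>x. c * F x + d * G x) (\<lambda>x. c * u x + d * v x) (\<lambda>x. c * M x + d * N x)"
proof -
  have "deriv_on (\<lambda>x. c * u x + d * v x)
      (((c * M x + d * N x) + \<beta> x * (c * u x + d * v x) / 2) / \<eta> x) x"
    (is "deriv_on _ ?A x") if x: "x \<in> {0..l}" for x
  proof -
    have "?A = c * ((M x + \<beta> x * u x / 2) / \<eta> x) + d * ((N x + \<beta> x * v x / 2) / \<eta> x)"
      using eta_nz[OF x] by (simp add: field_simps)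
    then show ?thesis
      by (simp only:)
         (intro DERIV_add DERIV_cmult flux_system_u[OF assms(1) x] flux_system_u[OF assms(2) x])
  qed
  moreover have "deriv_on (\<lambda>x. c * M x + d * N x)
      ((3 * \<alpha> x * (c * u x + d * v x) - \<beta> x * (c * M x + d * N x) / 2
        - 3 * (c * F x + d * G x)) / \<eta> x) x" (is "deriv_on _ ?A x") if x: "x \<in> {0..l}" for x
  proof -
    have "?A = c * ((3 * \<alpha> x * u x - \<beta> x * M x / 2 - 3 * F x) / \<eta> x)
        + d * ((3 * \<alpha> x * v x - \<beta> x * N x / 2 - 3 * G x) / \<eta> x)"
      using eta_nz[OF x] by (simp add: field_simps)
    then show ?thesis
      by (simp only:)
         (intro DERIV_add DERIV_cmult flux_system_M[OF assms(1) x] flux_system_M[OF assms(2) x])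
  qed
  ultimately show ?thesis unfolding flux_system_def by blast
qed

lemma flux_system_cong:
  assumes "flux_system F u M" "\<And>x. x \<in> {0..l} \<Longrightarrow> F x = G x"
    "\<And>x. x \<in> {0..l} \<Longrightarrow> u x = v x"
  shows "flux_system G v M"
proof -
  have "deriv_on v ((M x + \<beta> x * v x / 2) / \<eta> x) x \<and>
      deriv_on M ((3 * \<alpha> x * v x - \<beta> x * M x / 2 - 3 * G x) / \<eta> x) x" if x: "x \<in> {0..l}" for x
    using flux_system_u[OF assms(1) x] flux_system_M[OF assms(1) x] assms(2)[OF x] assms(3)[OF x]
      deriv_cong_on[of "{0..l}" u v, OF assms(3) x] by simp
  then show ?thesis unfolding flux_system_def by blast
qed

section \<open>Dirichlet problem for the flux system\<close>

text \<open>Energy identity: the terms in \<open>\<beta>\<close> cancel in the derivative of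
  \<open>u * M\<close>, which leaves the nonnegative \<open>g\<close>, positive wherever
  \<open>u\<close> is nonzero since \<open>\<alpha>\<close> is at least 1.\<close>

lemma flux_system_unique:
  assumes sys: "flux_system (\<lambda>_. 0) u M" and bc: "u 0 = 0" "u l = 0" and x: "x \<in> {0..l}"
  shows "u x = 0"
proof -
  define g where "g y = ((M y)\<^sup>2 + 3 * \<alpha> y * (u y)\<^sup>2) / \<eta> y" for y
  have dG: "deriv_on (\<lambda>y. u y * M y) (g y) y" if y: "y \<in> {0..l}" for y
  proof -
    have "(M y + \<beta> y * u y / 2) / \<eta> y * M y + (3 * \<alpha> y * u y - \<beta> y * M y / 2 - 3 * 0) / \<eta> y * u y = g y"
      unfolding g_def using eta_nz[OF y] by (simp add: field_simps power2_eq_square)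
    then show ?thesis
      using DERIV_mult[OF flux_system_u[OF sys y] flux_system_M[OF sys y]] by simp
  qed
  have g_nonneg: "0 \<le> g y" if "y \<in> {0..l}" for y
    unfolding g_def using hb_pos[OF that] alpha_ge1[of y] by (intro divide_nonneg_pos) auto
  have mono: "u y * M y \<le> u z * M z" if "0 \<le> y" "y \<le> z" "z \<le> l" for y z
    by (rule le_of_nonneg_deriv[of y z "\<lambda>y. u y * M y" g])
       (use that g_nonneg in \<open>auto intro: DERIV_subset[OF dG]\<close>)
  \<comment> \<open>A nondecreasing product that vanishes at both ends is squeezed to zero, hence
    its derivative \<open>g\<close> is zero too.\<close>
  have "u y * M y = 0" if "y \<in> {0..l}" for y
    using mono[of 0 y] mono[of y l] that bc by simp
  then have "deriv_on (\<lambda>_. 0) (g x) x"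
    using deriv_cong_on[of "{0..l}" "\<lambda>y. u y * M y" "\<lambda>_. 0" x "g x"] dG[OF x] x by simp
  then have "g x = 0"
    using D_eqI[OF l_pos x] DERIV_const[of 0] by (metis (no_types))
  then have "(M x)\<^sup>2 + 3 * \<alpha> x * (u x)\<^sup>2 = 0" unfolding g_def using eta_nz[OF x] by simp
  moreover have "0 \<le> (M x)\<^sup>2" "1 * (u x)\<^sup>2 \<le> \<alpha> x * (u x)\<^sup>2"
    by (simp, rule mult_right_mono[OF alpha_ge1]) simp
  ultimately have "(u x)\<^sup>2 \<le> 0" by linarith
  then show ?thesis by simp
qed

text \<open>The Liouville substitution \<open>u = U / sqrt \<eta>\<close>, \<open>M = sqrt \<eta> U'\<close> turns the system into
  \<open>U'' = (3 \<alpha> / \<eta>\<^sup>2) U - 3 F / (\<eta> sqrt \<eta>)\<close>.\<close>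

lemma flux_system_ivp:
  assumes F: "continuous_on {0..l} F"
  obtains u M where "flux_system F u M" "u 0 = u0" "M 0 = m0"
proof -
  define s where "s x = sqrt (\<eta> x)" for x
  have s_pos: "0 < s x" if "x \<in> {0..l}" for x unfolding s_def using hb_pos[OF that] by simp
  have ss: "s x * s x = \<eta> x" if "x \<in> {0..l}" for x unfolding s_def using hb_pos[OF that] by simp
  have ds: "deriv_on s (- \<beta> x / (2 * s x)) x" if x: "x \<in> {0..l}" for x
  proof -
    have "deriv_on (\<lambda>x. sqrt (\<eta> x)) (inverse (sqrt (\<eta> x)) / 2 * (- \<beta> x)) x"
      by (rule DERIV_chain2[OF DERIV_real_sqrt[OF hb_pos[OF x]] d_eta[OF x]])
    then show ?thesis unfolding s_def by (simp add: field_simps)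
  qed
  have cs: "continuous_on {0..l} s" by (rule continuous_on_of_deriv[OF ds])
  have snz: "\<forall>x\<in>{0..l}. \<eta> x * s x \<noteq> 0" "\<forall>x\<in>{0..l}. (\<eta> x)\<^sup>2 \<noteq> 0"
    using eta_nz s_pos by (simp_all add: less_imp_neq[THEN not_sym])
  have c1: "continuous_on {0..l} (\<lambda>x. 3 * \<alpha> x / (\<eta> x)\<^sup>2)"
    by (intro continuous_intros cont_bottom snz)
  have c2: "continuous_on {0..l} (\<lambda>x. - 3 * F x / (\<eta> x * s x))"
    by (intro continuous_intros cont_bottom F cs snz)
  obtain U U1 where U: "U 0 = s 0 * u0" "U1 0 = m0 / s 0"
    and dU: "\<And>x. x \<in> {0..l} \<Longrightarrow> deriv_on U (U1 x) x"
    and dU1: "\<And>x. x \<in> {0..l} \<Longrightarrow>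
      deriv_on U1 (3 * \<alpha> x / (\<eta> x)\<^sup>2 * U x + - 3 * F x / (\<eta> x * s x)) x"
    using linear_ode_ivp_exists[OF less_imp_le[OF l_pos] c1 c2, of "s 0 * u0" "m0 / s 0"] by blast
  have s0: "s 0 \<noteq> 0" using s_pos[of 0] l_pos by simp
  show ?thesis
  proof (rule that[of "\<lambda>x. U x / s x" "\<lambda>x. s x * U1 x"])
    show "flux_system F (\<lambda>x. U x / s x) (\<lambda>x. s x * U1 x)"
      unfolding flux_system_def
    proof (intro ballI conjI)
      fix x assume x: "x \<in> {0..l}"
      have nz: "s x \<noteq> 0" using s_pos[OF x] by simp
      \<comment> \<open>Once \<open>\<eta> x\<close> is replaced by \<open>s x * s x\<close>, this
        identity and \<open>eq2\<close> below are rational in \<open>s x\<close>.\<close>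
      have eq1: "(U1 x * s x - U x * (- \<beta> x / (2 * s x))) / (s x * s x)
          = (s x * U1 x + \<beta> x * (U x / s x) / 2) / \<eta> x"
        using nz unfolding ss[OF x, symmetric] by (simp add: field_simps)
      show "deriv_on (\<lambda>x. U x / s x) ((s x * U1 x + \<beta> x * (U x / s x) / 2) / \<eta> x) x"
        using DERIV_divide[OF dU[OF x] ds[OF x] nz] unfolding eq1 .
      have eq2: "(- \<beta> x / (2 * s x)) * U1 x
          + (3 * \<alpha> x / (\<eta> x)\<^sup>2 * U x + - 3 * F x / (\<eta> x * s x)) * s x
        = (3 * \<alpha> x * (U x / s x) - \<beta> x * (s x * U1 x) / 2 - 3 * F x) / \<eta> x"
        using nz unfolding ss[OF x, symmetric] by (simp add: field_simps power2_eq_square)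
      show "deriv_on (\<lambda>x. s x * U1 x)
          ((3 * \<alpha> x * (U x / s x) - \<beta> x * (s x * U1 x) / 2 - 3 * F x) / \<eta> x) x"
        using DERIV_mult[OF ds[OF x] dU1[OF x]] unfolding eq2 .
    qed
  qed (use U s0 in auto)
qed

text \<open>Shooting from the left end: a solution \<open>v\<close> with the right value at 0 is
  corrected by a multiple of a homogeneous solution \<open>w\<close> starting from 0. Uniqueness is
  what guarantees \<open>w l \<noteq> 0\<close>.\<close>

lemma flux_system_dirichlet:
  assumes F: "continuous_on {0..l} F"
  obtains u M where "flux_system F u M" "u 0 = c0" "u l = cl"
proof -
  obtain w N where w: "flux_system (\<lambda>_. 0) w N" "w 0 = 0" "N 0 = 1"
    by (rule flux_system_ivp[of "\<lambda>_. 0" 0 1]) auto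
  have l0: "0 \<in> {0..l}" using l_pos by simp
  have "w l \<noteq> 0"
  proof
    assume "w l = 0"
    then have z: "w x = 0" if "x \<in> {0..l}" for x using flux_system_unique[OF w(1,2) _ that] by blast
    \<comment> \<open>The system with \<open>w 0 = 0\<close> and \<open>N 0 = 1\<close> prescribes a
      nonzero slope at 0, which is incompatible with \<open>w\<close> vanishing identically.\<close>
    have "deriv_on w (1 / \<eta> 0) 0" using flux_system_u[OF w(1) l0] w(2,3) by simp
    then have "deriv_on (\<lambda>_. 0) (1 / \<eta> 0) 0"
      using deriv_cong_on[of "{0..l}" w "\<lambda>_. 0" 0] z l0 by blast
    then have "1 / \<eta> 0 = 0" using D_eqI[OF l_pos l0] DERIV_const[of 0] by (metis (no_types))
    then show False using eta_nz[OF l0] by simp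
  qed
  moreover obtain v K where v: "flux_system F v K" "v 0 = c0"
    by (rule flux_system_ivp[OF F, of c0 0]) auto
  ultimately show ?thesis
    using that[OF flux_system_cong[OF flux_system_lin[OF v(1) w(1), of 1 "(cl - v l) / w l"]]] w
    by fastforce
qed

section \<open>The differential operators in terms of fluxes\<close>

text \<open>The two contributions of \<open>\<gamma>\<close> cancel, and the terms in
  \<open>\<beta>\<close> squared turn the coefficient 1 of \<open>u\<close> into
  \<open>\<alpha>\<close>. Only differentiability of \<open>M\<close> at the single point
  \<open>x\<close> is assumed, so that the formula applies at almost every point to an
  \<open>H2\<close> function.\<close>

lemma one_plus_hbTb_eq:
  assumes du: "\<And>y. y \<in> {0..l} \<Longrightarrow> deriv_on u ((M y + \<beta> y * u y / 2) / \<eta> y) y"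
    and x: "x \<in> {0..l}" and dM: "deriv_on M m x"
  shows "one_plus_hbTb l h0 b u x = \<alpha> x * u x - (\<beta> x * M x / 2 + \<eta> x * m) / 3"
proof -
  have inner: "D l (\<lambda>z. u z / \<eta> z) y = (M y + 3 / 2 * \<beta> y * u y) / (\<eta> y)\<^sup>2" if y: "y \<in> {0..l}" for y
  proof -
    have "(((M y + \<beta> y * u y / 2) / \<eta> y) * \<eta> y - u y * (- \<beta> y)) / (\<eta> y * \<eta> y)
        = (M y + 3 / 2 * \<beta> y * u y) / (\<eta> y)\<^sup>2"
      using eta_nz[OF y] by (simp add: power2_eq_square)
    then show ?thesis
      using D_eqI[OF l_pos y DERIV_divide[OF du[OF y] d_eta[OF y] eta_nz[OF y]]] by simp
  qed
  have "D l (\<lambda>y. \<eta> y ^ 3 * D l (\<lambda>z. u z / \<eta> z) y) x = D l (\<lambda>y. \<eta> y * (M y + 3 / 2 * \<beta> y * u y)) x"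
    by (rule D_cong[OF _ x]) (use inner eta_nz in \<open>simp add: power2_eq_square power3_eq_cube\<close>)
  also have "\<dots> = - \<beta> x * (M x + 3 / 2 * \<beta> x * u x)
      + \<eta> x * (m + 3 / 2 * (\<gamma> x * u x + \<beta> x * ((M x + \<beta> x * u x / 2) / \<eta> x)))"
    by (rule D_eqI[OF l_pos x])
       (rule derivative_eq_intros d_eta[OF x] dM d_beta[OF x] du[OF x] refl | simp add: algebra_simps)+
  finally show ?thesis
    unfolding one_plus_hbTb_def Tb_def alphab_def using eta_nz[OF x]
    by (simp add: field_simps power2_eq_square)
qed

lemma hbS_adj_eq:
  assumes "x \<in> {0..l}" "deriv_on r r' x"
  shows "hbS_adj l h0 b r x = (\<eta> x * r' - \<beta> x * r x / 2) / sqrt 3"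
proof -
  have E: "D l (\<lambda>y. (\<eta> y)\<^sup>2 * r y) x = 2 * \<eta> x * (- \<beta> x) * r x + (\<eta> x)\<^sup>2 * r'"
    by (rule D_eqI[OF l_pos assms(1)])
       (rule derivative_eq_intros d_eta[OF assms(1)] assms(2) refl | simp)+
  have s3: "sqrt 3 / 2 = 3 / (2 * sqrt 3)" by (simp add: field_simps)
  show ?thesis
    unfolding hbS_adj_def E s3 using eta_nz[OF assms(1)]
    by (simp add: field_simps power2_eq_square)
qed

text \<open>Comparison with \<open>hbS_adj_eq\<close> shows that the operator is formally
  skew-adjoint: the same first order expression describes it and its adjoint, up to sign.\<close>

lemma hbS_eq:
  assumes "x \<in> {0..l}" "deriv_on p p' x"
  shows "hbS l h0 b p x = - (\<eta> x * p' - \<beta> x * p x / 2) / sqrt 3"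
proof -
  have "D l (\<lambda>y. p y / \<eta> y) x = (p' * \<eta> x - p x * (- \<beta> x)) / (\<eta> x * \<eta> x)"
    using D_eqI[OF l_pos assms(1) DERIV_divide[OF assms(2) d_eta[OF assms(1)] eta_nz[OF assms(1)]]] .
  moreover have "sqrt 3 * sqrt 3 = (3::real)" by simp
  ultimately show ?thesis
    unfolding hbS_def Sb_def using eta_nz[OF assms(1)]
    by (simp add: field_simps power2_eq_square)
qed

lemma hbS_cong:
  assumes "\<And>y. y \<in> {0..l} \<Longrightarrow> p y = p' y" "x \<in> {0..l}"
  shows "hbS l h0 b p x = hbS l h0 b p' x"
  unfolding hbS_def Sb_def
  using D_cong[of l "\<lambda>y. p y / \<eta> y" "\<lambda>y. p' y / \<eta> y" x] assms by simp

lemma one_plus_hbTb_flux_system: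
  assumes "flux_system F u M" "x \<in> {0..l}"
  shows "one_plus_hbTb l h0 b u x = F x"
  using one_plus_hbTb_eq[OF flux_system_u[OF assms(1)] assms(2) flux_system_M[OF assms]]
    eta_nz[OF assms(2)] by (simp add: field_simps)

text \<open>For a continuous source the right-hand sides of the system can be differentiated once
  more, so \<open>u\<close> is twice continuously differentiable; \<open>v\<close> and
  \<open>w\<close> are its explicit derivatives.\<close>

lemma flux_system_imp_dirichlet_sol:
  assumes sys: "flux_system F u M" and F: "continuous_on {0..l} F"
  shows "dirichlet_sol l h0 b F (u 0) (u l) u"
proof -
  note c = flux_system_cont[OF sys]
  define v where "v x = (M x + \<beta> x * u x / 2) / \<eta> x" for x
  define m where "m x = (3 * \<alpha> x * u x - \<beta> x * M x / 2 - 3 * F x) / \<eta> x" for x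
  have cm: "continuous_on {0..l} m" unfolding m_def using eta_nz
    by (auto intro!: continuous_intros cont_bottom F c)
  have cv: "continuous_on {0..l} v" unfolding v_def using eta_nz
    by (auto intro!: continuous_intros cont_bottom F c)
  define w where "w x = ((m x + (\<gamma> x * u x + \<beta> x * v x) / 2) * \<eta> x
      - (M x + \<beta> x * u x / 2) * (- \<beta> x)) / (\<eta> x * \<eta> x)" for x
  have "H2 l u"
  proof (rule H2_I[OF l_pos])
    show du: "deriv_on u (v x) x" if "x \<in> {0..l}" for x
      unfolding v_def by (rule flux_system_u[OF sys that])
    show "deriv_on v (w x) x" if x: "x \<in> {0..l}" for x
    proof -
      have "deriv_on (\<lambda>x. M x + \<beta> x * u x / 2) (m x + (\<gamma> x * u x + \<beta> x * v x) / 2) x"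
        using flux_system_M[OF sys x]
        by (auto intro!: derivative_eq_intros d_beta[OF x] du[OF x] simp: m_def)
      then show ?thesis unfolding v_def w_def
        using DERIV_divide[OF _ d_eta[OF x] eta_nz[OF x]] v_def by simp
    qed
    show "continuous_on {0..l} w" unfolding w_def using eta_nz
      by (auto intro!: continuous_intros cont_bottom cm cv c)
  qed
  moreover have "AE x\<in>{0<..<l} in lebesgue. one_plus_hbTb l h0 b u x = F x"
    by (intro AE_I2 impI one_plus_hbTb_flux_system[OF sys]) auto
  ultimately show ?thesis unfolding dirichlet_sol_def by simp
qed

text \<open>Elliptic regularity in dimension one: the equation solved for the second derivative
  gives a continuous function, and agreement almost everywhere is upgraded by
  \<open>H1_classical\<close>.\<close>

lemma dirichlet_sol_imp_flux_system:
  assumes sol: "dirichlet_sol l h0 b F c0 cl u" and F: "continuous_on {0..l} F"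
  obtains M where "flux_system F u M"
proof -
  have H: "H2 l u" using sol unfolding dirichlet_sol_def by blast
  then have H1: "H1 l (D l u)" unfolding H2_def by blast
  define v where "v = D l u"
  have du: "deriv_on u (v x) x" if "x \<in> {0..l}" for x
    unfolding v_def by (rule H2_deriv[OF l_pos H that])
  have cu: "continuous_on {0..l} u" by (rule continuous_on_of_deriv[OF du])
  have cv: "continuous_on {0..l} v" unfolding v_def by (rule H1_continuous_on[OF H1])
  define M where "M x = \<eta> x * v x - \<beta> x * u x / 2" for x
  have cM: "continuous_on {0..l} M" unfolding M_def
    by (auto intro!: continuous_intros cont_bottom cu cv)
  \<comment> \<open>\<open>m\<close> is the value which the equation imposes on the derivative of
    \<open>M\<close>, and \<open>w\<close> the resulting value of the second derivative of
    \<open>u\<close>.\<close>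
  define m where "m x = (3 * \<alpha> x * u x - \<beta> x * M x / 2 - 3 * F x) / \<eta> x" for x
  define w where "w x = (m x + \<beta> x * v x + (\<gamma> x * u x + \<beta> x * v x) / 2) / \<eta> x" for x
  have cw: "continuous_on {0..l} w" unfolding w_def m_def using eta_nz
    by (auto intro!: continuous_intros cont_bottom cu cv cM F)
  have du': "deriv_on u ((M x + \<beta> x * u x / 2) / \<eta> x) x" if "x \<in> {0..l}" for x
    using du[OF that] eta_nz[OF that] unfolding M_def by simp
  have dM: "deriv_on M (- \<beta> x * v x + \<eta> x * v' - (\<gamma> x * u x + \<beta> x * v x) / 2) x"
    if x: "x \<in> {0..l}" and "deriv_on v v' x" for x v'
    unfolding M_def
    by (rule derivative_eq_intros d_eta[OF x] d_beta[OF x] du[OF x] that(2) refl | simp)+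
  have "AE x\<in>{0<..<l} in lebesgue. D l (D l u) x = w x"
  proof -
    have "AE x in lebesgue. (x \<in> {0<..<l} \<longrightarrow> deriv_on (D l u) (D l (D l u) x) x) \<and>
        (x \<in> {0<..<l} \<longrightarrow> one_plus_hbTb l h0 b u x = F x)"
      using H2_deriv2_ae[OF l_pos H] sol unfolding dirichlet_sol_def by (intro AE_conjI) auto
    then show ?thesis
    proof (rule eventually_mono, intro impI)
      fix x
      assume A: "(x \<in> {0<..<l} \<longrightarrow> deriv_on (D l u) (D l (D l u) x) x) \<and>
        (x \<in> {0<..<l} \<longrightarrow> one_plus_hbTb l h0 b u x = F x)" and x: "x \<in> {0<..<l}"
      then have x': "x \<in> {0..l}" by auto
      have "F x = \<alpha> x * u x - (\<beta> x * M x / 2 + \<eta> x *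
          (- \<beta> x * v x + \<eta> x * D l (D l u) x - (\<gamma> x * u x + \<beta> x * v x) / 2)) / 3"
        using one_plus_hbTb_eq[of u M, OF du' x' dM[OF x']] A x unfolding v_def by auto
      then show "D l (D l u) x = w x"
        unfolding w_def m_def using eta_nz[OF x'] by (simp add: field_simps)
    qed
  qed
  then have dv: "deriv_on v (w x) x" if "x \<in> {0..l}" for x
    unfolding v_def using H1_classical[OF l_pos H1 cw _ that] by blast
  have "flux_system F u M"
    unfolding flux_system_def
  proof (intro ballI conjI du')
    fix x assume x: "x \<in> {0..l}"
    have "- \<beta> x * v x + \<eta> x * w x - (\<gamma> x * u x + \<beta> x * v x) / 2 = m x"
      unfolding w_def using eta_nz[OF x] by (simp add: field_simps)
    then show "deriv_on M ((3 * \<alpha> x * u x - \<beta> x * M x / 2 - 3 * F x) / \<eta> x) x"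
      using dM[OF x dv[OF x]] unfolding m_def by simp
  qed
  then show ?thesis using that by blast
qed

text \<open>Existence makes the choice in \<open>R0\<close>, \<open>s_left\<close> and
  \<open>s_right\<close> meaningful, and regularity makes the chosen function a solution of the flux
  system; nothing else about the choice is ever used.\<close>

lemma SOME_dirichlet_sol:
  assumes F: "continuous_on {0..l} F"
  obtains M where "flux_system F (SOME u. dirichlet_sol l h0 b F c0 cl u) M"
    "(SOME u. dirichlet_sol l h0 b F c0 cl u) 0 = c0"
    "(SOME u. dirichlet_sol l h0 b F c0 cl u) l = cl"
proof -
  obtain u M where "flux_system F u M" "u 0 = c0" "u l = cl"
    using flux_system_dirichlet[OF F] by blast
  then have "\<exists>u. dirichlet_sol l h0 b F c0 cl u"
    using flux_system_imp_dirichlet_sol[OF _ F] by blast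
  then have sol: "dirichlet_sol l h0 b F c0 cl (SOME u. dirichlet_sol l h0 b F c0 cl u)"
    by (rule someI_ex)
  obtain N where "flux_system F (SOME u. dirichlet_sol l h0 b F c0 cl u) N"
    by (rule dirichlet_sol_imp_flux_system[OF sol F])
  then show ?thesis using that sol unfolding dirichlet_sol_def by blast
qed

section \<open>The operator \<open>R1\<close> and its relation to a Dirichlet problem\<close>

text \<open>The predicate under the choice operator of \<open>R1\<close>, named so that existence
  and regularity can be stated about it.\<close>

definition R1_sol :: "(real \<Rightarrow> real) \<Rightarrow> (real \<Rightarrow> real) \<Rightarrow> bool" where
  "R1_sol \<phi> u \<longleftrightarrow> H2 l u \<and>
     (AE x\<in>{0<..<l} in lebesgue.
        u x + 1 / \<eta> x * hbS l h0 b (\<lambda>y. \<eta> y / \<alpha> y * hbS_adj l h0 b u y) x = \<phi> x) \<and>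
     hbS_adj l h0 b u 0 = 0 \<and> hbS_adj l h0 b u l = 0"

lemma sqrt3_div: "A / sqrt 3 = B \<longleftrightarrow> A = sqrt 3 * B"
  by (auto simp: field_simps)

text \<open>The same regularity argument as for the Dirichlet problem, now producing a first order
  system for the pair \<open>r\<close>, \<open>p\<close>. The second equation is the defining
  equation of \<open>r\<close> solved for the derivative of \<open>p\<close>.\<close>

lemma R1_sol_classical:
  fixes r
  defines "p \<equiv> \<lambda>x. \<eta> x / \<alpha> x * hbS_adj l h0 b r x"
  assumes sol: "R1_sol \<phi> r" and \<phi>: "continuous_on {0..l} \<phi>" and x: "x \<in> {0..l}"
  shows "deriv_on r ((sqrt 3 * \<alpha> x * p x / \<eta> x + \<beta> x * r x / 2) / \<eta> x) x"
    and "deriv_on p ((\<beta> x * p x / 2 - sqrt 3 * \<eta> x * (\<phi> x - r x)) / \<eta> x) x"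
proof -
  have H: "H2 l r" using sol unfolding R1_sol_def by blast
  then have H1: "H1 l (D l r)" unfolding H2_def by blast
  define v where "v = D l r"
  have dr: "deriv_on r (v x) x" if "x \<in> {0..l}" for x
    unfolding v_def by (rule H2_deriv[OF l_pos H that])
  have cr: "continuous_on {0..l} r" by (rule continuous_on_of_deriv[OF dr])
  have cv: "continuous_on {0..l} v" unfolding v_def by (rule H1_continuous_on[OF H1])
  \<comment> \<open>By \<open>hbS_adj_eq\<close>, \<open>p\<close> factors as
    \<open>\<kappa> * N\<close>, where \<open>N\<close> contains the first derivative of
    \<open>r\<close>; differentiating the product thus brings in the second derivative linearly,
    with the nonzero coefficient \<open>\<kappa> * \<eta>\<close>.\<close>
  define \<kappa> where "\<kappa> x = \<eta> x / (sqrt 3 * \<alpha> x)" for x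
  define \<kappa>' where
    "\<kappa>' x = (- \<beta> x * (sqrt 3 * \<alpha> x) - \<eta> x * (sqrt 3 * (\<beta> x * \<gamma> x / 2))) / ((sqrt 3 * \<alpha> x) * (sqrt 3 * \<alpha> x))" for x
  have d\<kappa>: "deriv_on \<kappa> (\<kappa>' x) x" if x: "x \<in> {0..l}" for x
    unfolding \<kappa>_def \<kappa>'_def
    by (rule DERIV_divide[OF d_eta[OF x] DERIV_cmult[OF d_alpha[OF x]]]) simp
  have c\<kappa>: "continuous_on {0..l} \<kappa>" by (rule continuous_on_of_deriv[OF d\<kappa>])
  have c\<kappa>': "continuous_on {0..l} \<kappa>'" unfolding \<kappa>'_def
    by (auto intro!: continuous_intros cont_bottom)
  have \<kappa>nz: "\<kappa> x \<noteq> 0" if "x \<in> {0..l}" for x unfolding \<kappa>_def using eta_nz[OF that] by simp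
  define N where "N x = \<eta> x * v x - \<beta> x * r x / 2" for x
  have cN: "continuous_on {0..l} N" unfolding N_def
    by (auto intro!: continuous_intros cont_bottom cr cv)
  have p: "p x = \<kappa> x * N x" if "x \<in> {0..l}" for x
    unfolding p_def \<kappa>_def N_def using hbS_adj_eq[OF that dr[OF that]] by simp
  have cp: "continuous_on {0..l} p"
    by (rule continuous_on_eq[of _ "\<lambda>x. \<kappa> x * N x"])
       (auto intro!: continuous_intros c\<kappa> cN simp: p)
  define p1 where "p1 x = (\<beta> x * p x / 2 - sqrt 3 * \<eta> x * (\<phi> x - r x)) / \<eta> x" for x
  have cp1: "continuous_on {0..l} p1" unfolding p1_def using eta_nz
    by (auto intro!: continuous_intros cont_bottom cp cr \<phi>)
  define w where "w x = ((p1 x - \<kappa>' x * N x) / \<kappa> x + \<beta> x * v x + (\<gamma> x * r x + \<beta> x * v x) / 2) / \<eta> x" for x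
  have cw: "continuous_on {0..l} w" unfolding w_def using eta_nz \<kappa>nz
    by (auto intro!: continuous_intros cont_bottom c\<kappa> c\<kappa>' cp1 cN cv cr)
  have dN: "deriv_on N (- \<beta> x * v x + \<eta> x * v' - (\<gamma> x * r x + \<beta> x * v x) / 2) x"
    if x: "x \<in> {0..l}" and "deriv_on v v' x" for x v'
    unfolding N_def
    by (rule derivative_eq_intros d_eta[OF x] d_beta[OF x] dr[OF x] that(2) refl | simp)+
  have dp: "deriv_on p (\<kappa>' x * N x + \<kappa> x * (- \<beta> x * v x + \<eta> x * v' - (\<gamma> x * r x + \<beta> x * v x) / 2)) x"
    if x: "x \<in> {0..l}" and "deriv_on v v' x" for x v'
  proof -
    have "deriv_on (\<lambda>x. \<kappa> x * N x)
        (\<kappa>' x * N x + \<kappa> x * (- \<beta> x * v x + \<eta> x * v' - (\<gamma> x * r x + \<beta> x * v x) / 2)) x"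
      using DERIV_mult[OF d\<kappa>[OF x] dN[OF that]] by (simp add: mult.commute)
    then show ?thesis using deriv_cong_on[of "{0..l}" p "\<lambda>x. \<kappa> x * N x", OF p x] by blast
  qed
  have "AE x\<in>{0<..<l} in lebesgue. D l (D l r) x = w x"
  proof -
    have "AE x in lebesgue. (x \<in> {0<..<l} \<longrightarrow> deriv_on (D l r) (D l (D l r) x) x) \<and>
        (x \<in> {0<..<l} \<longrightarrow> r x + 1 / \<eta> x * hbS l h0 b p x = \<phi> x)"
      using H2_deriv2_ae[OF l_pos H] sol unfolding R1_sol_def p_def by (intro AE_conjI) auto
    then show ?thesis
    proof (rule eventually_mono, intro impI)
      fix x
      assume A: "(x \<in> {0<..<l} \<longrightarrow> deriv_on (D l r) (D l (D l r) x) x) \<and>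
        (x \<in> {0<..<l} \<longrightarrow> r x + 1 / \<eta> x * hbS l h0 b p x = \<phi> x)" and x: "x \<in> {0<..<l}"
      then have x': "x \<in> {0..l}" by auto
      define q where "q = \<kappa>' x * N x
        + \<kappa> x * (- \<beta> x * v x + \<eta> x * D l (D l r) x - (\<gamma> x * r x + \<beta> x * v x) / 2)"
      have dq: "deriv_on p q x" unfolding q_def by (rule dp[OF x']) (use A x v_def in auto)
      have "r x + 1 / \<eta> x * (- (\<eta> x * q - \<beta> x * p x / 2) / sqrt 3) = \<phi> x"
        using A x hbS_eq[OF x' dq] by auto
      then have "- (\<eta> x * q - \<beta> x * p x / 2) / sqrt 3 = \<eta> x * (\<phi> x - r x)"
        using eta_nz[OF x'] by (simp add: field_simps)
      then have "- (\<eta> x * q - \<beta> x * p x / 2) = sqrt 3 * (\<eta> x * (\<phi> x - r x))"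
        unfolding sqrt3_div .
      then have "q = p1 x" unfolding p1_def using eta_nz[OF x'] by (simp add: eq_divide_eq algebra_simps)
      then have "\<eta> x * D l (D l r) x
          = (p1 x - \<kappa>' x * N x) / \<kappa> x + \<beta> x * v x + (\<gamma> x * r x + \<beta> x * v x) / 2"
        unfolding q_def using \<kappa>nz[OF x'] by (simp add: field_simps)
      then show "D l (D l r) x = w x"
        unfolding w_def using eta_nz[OF x'] by (simp add: eq_divide_eq mult.commute)
    qed
  qed
  then have dv: "deriv_on v (w x) x"
    unfolding v_def using H1_classical[OF l_pos H1 cw _ x] by blast
  have "\<kappa>' x * N x + \<kappa> x * (- \<beta> x * v x + \<eta> x * w x - (\<gamma> x * r x + \<beta> x * v x) / 2) = p1 x"
    unfolding w_def using eta_nz[OF x] \<kappa>nz[OF x] by simp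
  then show "deriv_on p ((\<beta> x * p x / 2 - sqrt 3 * \<eta> x * (\<phi> x - r x)) / \<eta> x) x"
    using dp[OF x dv] unfolding p1_def by simp
  have "v x = (sqrt 3 * \<alpha> x * p x / \<eta> x + \<beta> x * r x / 2) / \<eta> x"
    using p[OF x] eta_nz[OF x] unfolding \<kappa>_def N_def by simp
  then show "deriv_on r ((sqrt 3 * \<alpha> x * p x / \<eta> x + \<beta> x * r x / 2) / \<eta> x) x"
    using dr[OF x] by simp
qed

text \<open>The problem for \<open>r\<close> is dual to a Dirichlet problem for p = (h_b / alpha_b)
  (h_b S)^* r, and is solved backwards from it. The boundary conditions on \<open>r\<close> become
  \<open>p 0 = 0\<close> and \<open>p l = 0\<close>.\<close>

lemma R1_sol_exists:
  assumes d\<phi>: "\<And>x. x \<in> {0..l} \<Longrightarrow> deriv_on \<phi> (\<phi>' x) x" and c\<phi>': "continuous_on {0..l} \<phi>'"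
  shows "\<exists>r. R1_sol \<phi> r"
proof -
  have c\<phi>: "continuous_on {0..l} \<phi>" by (rule continuous_on_of_deriv[OF d\<phi>])
  \<comment> \<open>This is h_b (h_b S)^* applied to \<open>\<phi>\<close>, obtained by applying h_b
    (h_b S)^* to the equation for \<open>r\<close>.\<close>
  define F where "F x = \<eta> x * (\<eta> x * \<phi>' x - \<beta> x * \<phi> x / 2) / sqrt 3" for x
  have cF: "continuous_on {0..l} F" unfolding F_def
    by (auto intro!: continuous_intros cont_bottom c\<phi> c\<phi>')
  obtain p M where sys: "flux_system F p M" and bc: "p 0 = 0" "p l = 0"
    by (rule flux_system_dirichlet[OF cF])
  note c = flux_system_cont[OF sys]
  \<comment> \<open>Since \<open>M\<close> is - sqrt 3 times (h_b S) p, this is the equation for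
    \<open>r\<close> read as a formula giving \<open>r\<close> from \<open>p\<close>.\<close>
  define r where "r x = \<phi> x + M x / (sqrt 3 * \<eta> x)" for x
  have cr: "continuous_on {0..l} r" unfolding r_def using eta_nz
    by (auto intro!: continuous_intros cont_bottom c\<phi> c)
  define v where "v x = (sqrt 3 * \<alpha> x * p x / \<eta> x + \<beta> x * r x / 2) / \<eta> x" for x
  have cv: "continuous_on {0..l} v" unfolding v_def using eta_nz
    by (auto intro!: continuous_intros cont_bottom cr c)
  have s3: "sqrt 3 * (sqrt 3 * z) = 3 * z" for z :: real
    by (metis mult.assoc real_sqrt_mult_self abs_numeral)
  have dr: "deriv_on r (v x) x" if x: "x \<in> {0..l}" for x
  proof -
    have nz: "sqrt 3 * \<eta> x \<noteq> 0" using eta_nz[OF x] by simp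
    have "deriv_on r (\<phi>' x + ((3 * \<alpha> x * p x - \<beta> x * M x / 2 - 3 * F x) / \<eta> x * (sqrt 3 * \<eta> x)
        - M x * (sqrt 3 * - \<beta> x)) / ((sqrt 3 * \<eta> x) * (sqrt 3 * \<eta> x))) x" (is "deriv_on r ?A x")
      unfolding r_def
      by (rule DERIV_add[OF d\<phi>[OF x] DERIV_divide[OF flux_system_M[OF sys x] DERIV_cmult[OF d_eta[OF x]] nz]])
    moreover have "?A = v x"
    proof -
      have M: "M x = sqrt 3 * \<eta> x * (r x - \<phi> x)" unfolding r_def using eta_nz[OF x] by simp
      have F3: "3 * F x = sqrt 3 * \<eta> x * (\<eta> x * \<phi>' x - \<beta> x * \<phi> x / 2)"
        unfolding F_def by (simp add: sqrt3_div s3[symmetric] mult.assoc)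
      have "3 * \<alpha> x * p x = sqrt 3 * (sqrt 3 * (\<alpha> x * p x))" using s3 by simp
      then show ?thesis unfolding v_def M F3 using eta_nz[OF x]
        by (simp add: field_simps)
    qed
    ultimately show ?thesis by simp
  qed
  define p1 where "p1 x = (M x + \<beta> x * p x / 2) / \<eta> x" for x
  have dp: "deriv_on p (p1 x) x" if "x \<in> {0..l}" for x
    unfolding p1_def by (rule flux_system_u[OF sys that])
  have cp1: "continuous_on {0..l} p1" unfolding p1_def using eta_nz
    by (auto intro!: continuous_intros cont_bottom c)
  define a where "a x = sqrt 3 * \<alpha> x * p x / \<eta> x + \<beta> x * r x / 2" for x
  define a1 where "a1 x = ((sqrt 3 * (\<beta> x * \<gamma> x / 2) * p x + sqrt 3 * \<alpha> x * p1 x) * \<eta> x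
      - sqrt 3 * \<alpha> x * p x * (- \<beta> x)) / (\<eta> x * \<eta> x) + (\<gamma> x * r x + \<beta> x * v x) / 2" for x
  define w where "w x = (a1 x * \<eta> x - a x * (- \<beta> x)) / (\<eta> x * \<eta> x)" for x
  have ca: "continuous_on {0..l} a" unfolding a_def using eta_nz
    by (auto intro!: continuous_intros cont_bottom cr c)
  have ca1: "continuous_on {0..l} a1" unfolding a1_def using eta_nz
    by (auto intro!: continuous_intros cont_bottom cr c cp1 cv)
  have cw: "continuous_on {0..l} w" unfolding w_def using eta_nz
    by (auto intro!: continuous_intros cont_bottom ca ca1)
  have da: "deriv_on a (a1 x) x" if x: "x \<in> {0..l}" for x
  proof -
    have "deriv_on (\<lambda>x. sqrt 3 * \<alpha> x * p x) (sqrt 3 * (\<beta> x * \<gamma> x / 2) * p x + sqrt 3 * \<alpha> x * p1 x) x"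
      by (rule derivative_eq_intros d_alpha[OF x] dp[OF x] refl | simp)+
    from DERIV_divide[OF this d_eta[OF x] eta_nz[OF x]]
    have 1: "deriv_on (\<lambda>x. sqrt 3 * \<alpha> x * p x / \<eta> x)
        (((sqrt 3 * (\<beta> x * \<gamma> x / 2) * p x + sqrt 3 * \<alpha> x * p1 x) * \<eta> x
          - sqrt 3 * \<alpha> x * p x * (- \<beta> x)) / (\<eta> x * \<eta> x)) x" .
    have 2: "deriv_on (\<lambda>x. \<beta> x * r x / 2) ((\<gamma> x * r x + \<beta> x * v x) / 2) x"
      by (rule derivative_eq_intros d_beta[OF x] dr[OF x] refl | simp)+
    show ?thesis unfolding a_def a1_def by (rule DERIV_add[OF 1 2])
  qed
  have dv: "deriv_on v (w x) x" if x: "x \<in> {0..l}" for x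
    using DERIV_divide[OF da[OF x] d_eta[OF x] eta_nz[OF x]] unfolding w_def v_def a_def .
  have "H2 l r" by (rule H2_I[OF l_pos dr dv cw])
  moreover have adj: "hbS_adj l h0 b r x = \<alpha> x * p x / \<eta> x" if x: "x \<in> {0..l}" for x
    unfolding hbS_adj_eq[OF x dr[OF x]] sqrt3_div v_def using eta_nz[OF x] by simp
  moreover have "r x + 1 / \<eta> x * hbS l h0 b (\<lambda>y. \<eta> y / \<alpha> y * hbS_adj l h0 b r y) x = \<phi> x"
    if "x \<in> {0<..<l}" for x
  proof -
    have x: "x \<in> {0..l}" using that by auto
    have "hbS l h0 b (\<lambda>y. \<eta> y / \<alpha> y * hbS_adj l h0 b r y) x = hbS l h0 b p x"
      by (rule hbS_cong[OF _ x]) (use adj eta_nz in simp)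
    also have "\<dots> = - M x / sqrt 3"
      unfolding hbS_eq[OF x dp[OF x]] p1_def using eta_nz[OF x] by simp
    finally show ?thesis unfolding r_def by simp
  qed
  moreover have "hbS_adj l h0 b r 0 = 0" "hbS_adj l h0 b r l = 0"
    using adj[of 0] adj[of l] bc l_pos by auto
  ultimately have "R1_sol \<phi> r" unfolding R1_sol_def by (intro conjI AE_I2 impI) auto
  then show ?thesis by blast
qed

text \<open>After multiplication of \<open>p\<close> by sqrt 3, the two equations of
  \<open>R1_sol_classical\<close> are exactly a flux system with flux
  \<open>3 * \<eta> x * (r x - \<phi> x)\<close>. This flux is later read at the ends to obtain the
  slope of \<open>P\<close> there.\<close>

lemma R1_flux_system:
  fixes \<phi>
  defines "r \<equiv> R1 l h0 b \<phi>"
  defines "P \<equiv> \<lambda>x. sqrt 3 * (\<eta> x / \<alpha> x) * hbS_adj l h0 b r x"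
  assumes d\<phi>: "\<And>x. x \<in> {0..l} \<Longrightarrow> deriv_on \<phi> (\<phi>' x) x" and c\<phi>': "continuous_on {0..l} \<phi>'"
  shows "flux_system (\<lambda>x. \<eta> x * (\<eta> x * \<phi>' x - \<beta> x * \<phi> x / 2)) P (\<lambda>x. 3 * \<eta> x * (r x - \<phi> x))"
    and "P 0 = 0" "P l = 0"
proof -
  have c\<phi>: "continuous_on {0..l} \<phi>" by (rule continuous_on_of_deriv[OF d\<phi>])
  have "r = (SOME u. R1_sol \<phi> u)" unfolding r_def R1_def R1_sol_def ..
  then have sol: "R1_sol \<phi> r" using someI_ex[OF R1_sol_exists[OF d\<phi> c\<phi>']] by simp
  then show "P 0 = 0" "P l = 0" unfolding P_def R1_sol_def by simp_all
  have s3: "sqrt 3 * (sqrt 3 * z) = 3 * z" for z :: real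
    by (metis mult.assoc real_sqrt_mult_self abs_numeral)
  show "flux_system (\<lambda>x. \<eta> x * (\<eta> x * \<phi>' x - \<beta> x * \<phi> x / 2)) P (\<lambda>x. 3 * \<eta> x * (r x - \<phi> x))"
    unfolding flux_system_def
  proof (intro ballI conjI)
    fix x assume x: "x \<in> {0..l}"
    define p where "p = (\<lambda>x. \<eta> x / \<alpha> x * hbS_adj l h0 b r x)"
    have P: "P = (\<lambda>x. sqrt 3 * p x)" unfolding P_def p_def by (simp add: mult.assoc)
    have dr: "deriv_on r ((sqrt 3 * \<alpha> x * p x / \<eta> x + \<beta> x * r x / 2) / \<eta> x) x"
      and dp: "deriv_on p ((\<beta> x * p x / 2 - sqrt 3 * \<eta> x * (\<phi> x - r x)) / \<eta> x) x"
      using R1_sol_classical[OF sol c\<phi> x] unfolding p_def .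
    have "sqrt 3 * ((\<beta> x * p x / 2 - sqrt 3 * \<eta> x * (\<phi> x - r x)) / \<eta> x)
        = (3 * \<eta> x * (r x - \<phi> x) + \<beta> x * P x / 2) / \<eta> x"
      unfolding P using s3[of "\<eta> x * (\<phi> x - r x)"] eta_nz[OF x] by (simp add: field_simps)
    then show "deriv_on P ((3 * \<eta> x * (r x - \<phi> x) + \<beta> x * P x / 2) / \<eta> x) x"
      using DERIV_cmult[OF dp, of "sqrt 3"] unfolding P by (simp only:)
    have "deriv_on (\<lambda>x. 3 * \<eta> x * (r x - \<phi> x)) (3 * (- \<beta> x) * (r x - \<phi> x)
        + 3 * \<eta> x * ((sqrt 3 * \<alpha> x * p x / \<eta> x + \<beta> x * r x / 2) / \<eta> x - \<phi>' x)) x" (is "deriv_on _ ?A x")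
      by (rule derivative_eq_intros d_eta[OF x] dr d\<phi>[OF x] refl | simp)+
    moreover have "?A = (3 * \<alpha> x * P x - \<beta> x * (3 * \<eta> x * (r x - \<phi> x)) / 2
        - 3 * (\<eta> x * (\<eta> x * \<phi>' x - \<beta> x * \<phi> x / 2))) / \<eta> x"
      unfolding P using eta_nz[OF x] by (simp add: field_simps)
    ultimately show "deriv_on (\<lambda>x. 3 * \<eta> x * (r x - \<phi> x))
        ((3 * \<alpha> x * P x - \<beta> x * (3 * \<eta> x * (r x - \<phi> x)) / 2
          - 3 * (\<eta> x * (\<eta> x * \<phi>' x - \<beta> x * \<phi> x / 2))) / \<eta> x) x" by simp
  qed
qed

lemma f_NSW_deriv:
  assumes x: "x \<in> {0..l}" and dZ: "deriv_on Z Z' x" and dQ: "deriv_on Q Q' x"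
    and nz: "depth h0 b x (Z x) \<noteq> 0"
  shows "deriv_on (\<lambda>y. f_NSW grav h0 b y (Z y) (Q y))
    (grav * depth h0 b x (Z x) * (Z' - \<beta> x)
      + (2 * Q x * Q' * depth h0 b x (Z x) - (Q x)\<^sup>2 * (Z' - \<beta> x)) / (depth h0 b x (Z x))\<^sup>2) x"
proof -
  define d where "d y = depth h0 b y (Z y)" for y
  have dd: "deriv_on d (Z' - \<beta> x) x"
    unfolding d_def depth_def using dZ has_derivative_D[OF b_diff x]
    by (auto intro!: derivative_eq_intros)
  have nz': "d x \<noteq> 0" using nz unfolding d_def .
  have dQ2: "deriv_on (\<lambda>y. (Q y)\<^sup>2) (2 * Q x * Q') x"
    by (rule derivative_eq_intros dQ refl | simp)+
  have "deriv_on (\<lambda>y. 1/2 * grav * ((d y)\<^sup>2 - h0\<^sup>2)) (grav * d x * (Z' - \<beta> x)) x"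
    by (rule derivative_eq_intros dd refl | simp)+
  moreover have "deriv_on (\<lambda>y. (Q y)\<^sup>2 / d y)
      ((2 * Q x * Q' * d x - (Q x)\<^sup>2 * (Z' - \<beta> x)) / (d x * d x)) x"
    by (rule DERIV_divide[OF dQ2 dd nz'])
  ultimately have "deriv_on (\<lambda>y. 1/2 * grav * ((d y)\<^sup>2 - h0\<^sup>2) + (Q y)\<^sup>2 / d y)
      (grav * d x * (Z' - \<beta> x) + (2 * Q x * Q' * d x - (Q x)\<^sup>2 * (Z' - \<beta> x)) / (d x * d x)) x"
    by (rule DERIV_add)
  then show ?thesis unfolding f_NSW_def d_def by (simp add: power2_eq_square)
qed

end

text \<open>A positive lower bound on the open interval passes to the ends by continuity.\<close>

lemma bottom_intro:
  assumes l: "0 < l" and b: "smooth_upto l b" and inf: "(INF x\<in>{0<..<l}. hb h0 b x) > 0"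
  shows "bottom l h0 b"
proof
  have s: "((D l) ^^ n) b differentiable_on {0..l}" for n
    using b unfolding smooth_upto_def by blast
  show d: "b differentiable_on {0..l}" "D l b differentiable_on {0..l}"
    "D l (D l b) differentiable_on {0..l}"
    using s[of 0] s[of 1] s[of 2] by (simp_all add: numeral_2_eq_2)
  fix x assume x: "x \<in> {0..l}"
  have cl: "closure {0<..<l} = {0..l}" using l by simp
  have c: "continuous_on {0..l} (hb h0 b)"
    unfolding hb_def by (intro continuous_intros differentiable_imp_continuous_on[OF d(1)])
  \<comment> \<open>The real infimum is a genuine lower bound only for a set that is bounded below,
    hence the detour through compactness.\<close>
  have "bounded (hb h0 b ` {0..l})" by (intro compact_imp_bounded compact_continuous_image c) simp
  then have "bounded (hb h0 b ` {0<..<l})" by (rule bounded_subset) auto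
  then have "bdd_below (hb h0 b ` {0<..<l})" by (rule bounded_imp_bdd_below)
  then have "(INF x\<in>{0<..<l}. hb h0 b x) \<le> hb h0 b y" if "y \<in> {0<..<l}" for y
    using that by (rule cINF_lower)
  then have "(INF x\<in>{0<..<l}. hb h0 b x) \<le> hb h0 b x"
    using continuous_ge_on_closure[of "{0<..<l}" "hb h0 b" x] c x unfolding cl by blast
  then show "0 < hb h0 b x" using inf by linarith
qed (fact l)

section \<open>The momentum equation at a fixed time\<close>

locale profile = bottom +
  fixes grav :: real and Z Q Z' Q' :: "real \<Rightarrow> real"
  assumes dZ: "\<And>x. x \<in> {0..l} \<Longrightarrow> (Z has_real_derivative Z' x) (at x within {0..l})"
    and dQ: "\<And>x. x \<in> {0..l} \<Longrightarrow> (Q has_real_derivative Q' x) (at x within {0..l})"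
    and cZ': "continuous_on {0..l} Z'" and cQ': "continuous_on {0..l} Q'"
    and depth_nz: "\<And>x. x \<in> {0..l} \<Longrightarrow> depth h0 b x (Z x) \<noteq> 0"
begin

abbreviation \<delta> where "\<delta> \<equiv> \<lambda>x. depth h0 b x (Z x)"
abbreviation f where "f \<equiv> \<lambda>x. f_NSW grav h0 b x (Z x) (Q x)"
abbreviation r where "r \<equiv> R1_flux l grav h0 b Z Q"
abbreviation B where "B \<equiv> B_src l grav h0 b Z Q"
abbreviation P where "P \<equiv> \<lambda>x. sqrt 3 * (\<eta> x / \<alpha> x) * hbS_adj l h0 b r x"
abbreviation sl where "sl \<equiv> s_left l h0 b"
abbreviation sr where "sr \<equiv> s_right l h0 b"
abbreviation R0B where "R0B \<equiv> R0 l h0 b B"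

definition f' where
  "f' x = grav * \<delta> x * (Z' x - \<beta> x)
      + (2 * Q x * Q' x * \<delta> x - (Q x)\<^sup>2 * (Z' x - \<beta> x)) / (\<delta> x)\<^sup>2"

lemma df: "x \<in> {0..l} \<Longrightarrow> deriv_on f (f' x) x"
  unfolding f'_def by (intro f_NSW_deriv dZ dQ depth_nz)

lemma c_depth: "continuous_on {0..l} \<delta>"
  unfolding depth_def
  by (intro continuous_intros continuous_on_of_deriv[OF dZ] differentiable_imp_continuous_on[OF b_diff])

lemma c_f: "continuous_on {0..l} f"
  by (rule continuous_on_of_deriv[OF df])

lemma c_f': "continuous_on {0..l} f'"
  unfolding f'_def using depth_nz
  by (auto intro!: continuous_intros c_depth cont_bottom continuous_on_of_deriv[OF dQ] cZ' cQ')

lemma c_B: "continuous_on {0..l} B"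
  unfolding B_src_def using eta_nz
  by (auto intro!: continuous_intros cont_bottom c_depth c_f)

text \<open>For \<open>\<phi>\<close> equal to \<open>f\<close> divided by the square of
  \<open>\<eta>\<close>, the source in \<open>R1_flux_system\<close> expands to \<open>f'\<close>
  plus a term of order zero, which is the second term of \<open>B\<close>.\<close>

lemma flux_part:
  "flux_system (\<lambda>x. f' x + 3 / 2 * (\<beta> x / \<eta> x) * f x) P
     (\<lambda>x. 3 * \<eta> x * (r x - 1 / (\<eta> x)\<^sup>2 * f x))"
  "P 0 = 0" "P l = 0"
proof -
  define \<phi> where "\<phi> x = 1 / (\<eta> x)\<^sup>2 * f x" for x
  define \<phi>' where "\<phi>' x = (f' x * (\<eta> x)\<^sup>2 - f x * (2 * \<eta> x * (- \<beta> x))) / ((\<eta> x)\<^sup>2 * (\<eta> x)\<^sup>2)" for x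
  have r: "r = R1 l h0 b \<phi>" unfolding R1_flux_def \<phi>_def ..
  have d\<phi>: "deriv_on \<phi> (\<phi>' x) x" if x: "x \<in> {0..l}" for x
  proof -
    have "deriv_on (\<lambda>x. (\<eta> x)\<^sup>2) (2 * \<eta> x * (- \<beta> x)) x"
      by (rule derivative_eq_intros d_eta[OF x] refl | simp)+
    from DERIV_divide[OF df[OF x] this] show ?thesis
      unfolding \<phi>_def \<phi>'_def using eta_nz[OF x] by simp
  qed
  have c\<phi>': "continuous_on {0..l} \<phi>'" unfolding \<phi>'_def using eta_nz
    by (auto intro!: continuous_intros cont_bottom c_f c_f')
  note R = R1_flux_system[OF d\<phi> c\<phi>', folded r]
  show "P 0 = 0" "P l = 0" by (rule R(2), simp, rule R(3), simp)
  show "flux_system (\<lambda>x. f' x + 3 / 2 * (\<beta> x / \<eta> x) * f x) P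
     (\<lambda>x. 3 * \<eta> x * (r x - 1 / (\<eta> x)\<^sup>2 * f x))"
  proof (rule flux_system_cong[OF R(1), unfolded \<phi>_def])
    fix x assume x: "x \<in> {0..l}"
    show "\<eta> x * (\<eta> x * \<phi>' x - \<beta> x * (1 / (\<eta> x)\<^sup>2 * f x) / 2) = f' x + 3 / 2 * (\<beta> x / \<eta> x) * f x"
      unfolding \<phi>'_def using eta_nz[OF x] by (simp add: field_simps power2_eq_square)
  qed simp_all
qed

text \<open>In the difference of \<open>R0B\<close> and \<open>P\<close> the order zero terms in
  \<open>f\<close> cancel, and the boundary layers add no source. What remains is the source of the
  momentum equation, for any coefficients \<open>c\<close> and \<open>d\<close>.\<close>

lemma combination_flux_system:
  obtains M where
    "flux_system (\<lambda>x. - f' x - grav * \<delta> x * \<beta> x)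
      (\<lambda>x. R0B x + c * sl x + d * sr x - P x) M"
    "R0B 0 = 0" "R0B l = 0" "sl 0 = 1" "sl l = 0" "sr 0 = 0" "sr l = 1"
    "\<And>x. x \<in> {0..l} \<Longrightarrow> deriv_on R0B (D l R0B x) x"
    "\<And>x. x \<in> {0..l} \<Longrightarrow> deriv_on sl (D l sl x) x"
    "\<And>x. x \<in> {0..l} \<Longrightarrow> deriv_on sr (D l sr x) x"
proof -
  obtain M0 where 0: "flux_system B R0B M0" "R0B 0 = 0" "R0B l = 0"
    unfolding R0_def by (rule SOME_dirichlet_sol[OF c_B])
  have cz: "continuous_on {0..l} (\<lambda>_. 0 :: real)" by simp
  obtain M1 where 1: "flux_system (\<lambda>_. 0) sl M1" "sl 0 = 1" "sl l = 0"
    unfolding s_left_def by (rule SOME_dirichlet_sol[OF cz])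
  obtain M2 where 2: "flux_system (\<lambda>_. 0) sr M2" "sr 0 = 0" "sr l = 1"
    unfolding s_right_def by (rule SOME_dirichlet_sol[OF cz])
  have D: "deriv_on u (D l u x) x" if "flux_system F u M" "x \<in> {0..l}" for F u M x
    using flux_system_u[OF that] D_eqI[OF l_pos that(2) flux_system_u[OF that]] by simp
  note L = flux_system_lin[OF flux_system_lin[OF 0(1) flux_part(1), of 1 "-1"]
      flux_system_lin[OF 1(1) 2(1), of c d], of 1 1]
  have "flux_system (\<lambda>x. - f' x - grav * \<delta> x * \<beta> x)
      (\<lambda>x. R0B x + c * sl x + d * sr x - P x)
      (\<lambda>x. 1 * (1 * M0 x + - 1 * (3 * \<eta> x * (r x - 1 / (\<eta> x)\<^sup>2 * f x))) + 1 * (c * M1 x + d * M2 x))"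
    by (rule flux_system_cong[OF L]) (simp_all add: B_src_def)
  then show ?thesis using that 0(2,3) 1(2,3) 2(2,3) D[OF 0(1)] D[OF 1(1)] D[OF 2(1)] by blast
qed

section \<open>Momentum equation versus boundary layer decomposition, with \<open>v\<close> standing
  for the time derivative of \<open>q\<close>\<close>

context
  fixes v v' v'' :: "real \<Rightarrow> real"
  assumes dv: "\<And>x. x \<in> {0..l} \<Longrightarrow> deriv_on v (v' x) x"
    and dv': "\<And>x. x \<in> {0..l} \<Longrightarrow> deriv_on v' (v'' x) x"
    and cv'': "continuous_on {0..l} v''"
begin

text \<open>Both sides solve the same flux system once \<open>P\<close> is moved to the right. Since
  \<open>R0B\<close> and \<open>P\<close> vanish at the ends, the coefficients \<open>v 0\<close>
  and \<open>v l\<close> make the traces agree, and uniqueness concludes.\<close>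

lemma momentum_imp_decomposition:
  assumes eq: "\<And>x. x \<in> {0<..<l} \<Longrightarrow> one_plus_hbTb l h0 b v x + D l f x = - grav * \<delta> x * \<beta> x"
    and x: "x \<in> {0..l}"
  shows "v x + P x = R0B x + v 0 * sl x + v l * sr x"
proof -
  define M where "M x = \<eta> x * v' x - \<beta> x * v x / 2" for x
  define m where "m x = - \<beta> x * v' x + \<eta> x * v'' x - (\<gamma> x * v x + \<beta> x * v' x) / 2" for x
  note cv = continuous_on_of_deriv[OF dv] and cv' = continuous_on_of_deriv[OF dv']
  have cM: "continuous_on {0..l} M" unfolding M_def
    by (auto intro!: continuous_intros cont_bottom cv cv')
  have cm: "continuous_on {0..l} m" unfolding m_def
    by (auto intro!: continuous_intros cont_bottom cv cv' cv'')
  have dM: "deriv_on M (m x) x" if x: "x \<in> {0..l}" for x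
    unfolding M_def m_def
    by (rule derivative_eq_intros d_eta[OF x] d_beta[OF x] dv[OF x] dv'[OF x] refl | simp)+
  have dvM: "deriv_on v ((M x + \<beta> x * v x / 2) / \<eta> x) x" if "x \<in> {0..l}" for x
    using dv[OF that] eta_nz[OF that] unfolding M_def by simp
  \<comment> \<open>The momentum equation is assumed in the interior; continuity of both sides
    carries it to the ends, as the flux system requires.\<close>
  have F: "\<alpha> x * v x - (\<beta> x * M x / 2 + \<eta> x * m x) / 3 = - f' x - grav * \<delta> x * \<beta> x"
    if "x \<in> {0..l}" for x
  proof (rule eq_on_closed_interval[OF l_pos _ _ _ that])
    show "continuous_on {0..l} (\<lambda>x. \<alpha> x * v x - (\<beta> x * M x / 2 + \<eta> x * m x) / 3)"
      by (auto intro!: continuous_intros cont_bottom cv cM cm)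
    show "continuous_on {0..l} (\<lambda>x. - f' x - grav * \<delta> x * \<beta> x)"
      by (intro continuous_intros cont_bottom c_f' c_depth)
    fix x assume x: "x \<in> {0<..<l}"
    then have x': "x \<in> {0..l}" by auto
    show "\<alpha> x * v x - (\<beta> x * M x / 2 + \<eta> x * m x) / 3 = - f' x - grav * \<delta> x * \<beta> x"
      using eq[OF x] one_plus_hbTb_eq[of v M, OF dvM x' dM[OF x']] D_eqI[OF l_pos x' df[OF x']] by simp
  qed
  have sys: "flux_system (\<lambda>x. - f' x - grav * \<delta> x * \<beta> x) v M"
    unfolding flux_system_def
  proof (intro ballI conjI dvM)
    fix x assume x: "x \<in> {0..l}"
    have "(3 * \<alpha> x * v x - \<beta> x * M x / 2 - 3 * (- f' x - grav * \<delta> x * \<beta> x)) / \<eta> x = m x"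
      unfolding F[OF x, symmetric] using eta_nz[OF x] by (simp add: field_simps)
    then show "deriv_on M ((3 * \<alpha> x * v x - \<beta> x * M x / 2 - 3 * (- f' x - grav * \<delta> x * \<beta> x)) / \<eta> x) x"
      using dM[OF x] by simp
  qed
  obtain N where N: "flux_system (\<lambda>x. - f' x - grav * \<delta> x * \<beta> x)
      (\<lambda>x. R0B x + v 0 * sl x + v l * sr x - P x) N"
    and bc: "R0B 0 = 0" "R0B l = 0" "sl 0 = 1" "sl l = 0" "sr 0 = 0" "sr l = 1"
    by (rule combination_flux_system)
  define W where "W x = v x - (R0B x + v 0 * sl x + v l * sr x - P x)" for x
  have "flux_system (\<lambda>_. 0) W (\<lambda>x. 1 * M x + -1 * N x)"
    by (rule flux_system_cong[OF flux_system_lin[OF sys N, of 1 "-1"]]) (simp_all add: W_def)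
  moreover have "W 0 = 0" "W l = 0" unfolding W_def bc flux_part(2,3) by simp_all
  ultimately have "W x = 0" by (rule flux_system_unique[OF _ _ _ x])
  then show ?thesis unfolding W_def by simp
qed

lemma decomposition_on_closed:
  assumes eq: "\<And>x. x \<in> {0<..<l} \<Longrightarrow> v x + P x = R0B x + c * sl x + d * sr x"
    and x: "x \<in> {0..l}"
  shows "v x + P x = R0B x + c * sl x + d * sr x"
proof -
  obtain M where "flux_system (\<lambda>x. - f' x - grav * \<delta> x * \<beta> x)
      (\<lambda>x. R0B x + c * sl x + d * sr x - P x) M"
    by (rule combination_flux_system)
  then have C: "continuous_on {0..l} (\<lambda>x. R0B x + c * sl x + d * sr x - P x)"
    by (rule flux_system_cont)
  have "v x = R0B x + c * sl x + d * sr x - P x"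
    by (rule eq_on_closed_interval[OF l_pos continuous_on_of_deriv[OF dv] C _ x]) (use eq in force)+
  then show ?thesis by simp
qed

context
  fixes c d :: real
  assumes eq: "\<And>x. x \<in> {0..l} \<Longrightarrow> v x + P x = R0B x + c * sl x + d * sr x"
begin

text \<open>\<open>v\<close> coincides with the combination, so it inherits its flux system, and the
  source is the right-hand side of the momentum equation.\<close>

lemma decomposition_imp_momentum:
  assumes x: "x \<in> {0..l}"
  shows "one_plus_hbTb l h0 b v x + D l f x = - grav * \<delta> x * \<beta> x"
proof -
  obtain M where M: "flux_system (\<lambda>x. - f' x - grav * \<delta> x * \<beta> x)
      (\<lambda>x. R0B x + c * sl x + d * sr x - P x) M"
    by (rule combination_flux_system)
  have "flux_system (\<lambda>x. - f' x - grav * \<delta> x * \<beta> x) v M"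
    by (rule flux_system_cong[OF M]) (use eq in force)+
  from one_plus_hbTb_flux_system[OF this x] show ?thesis
    using D_eqI[OF l_pos x df[OF x]] by simp
qed

lemma decomposition_trace: "v 0 = c" "v l = d"
proof -
  obtain M where M: "flux_system (\<lambda>x. - f' x - grav * \<delta> x * \<beta> x)
      (\<lambda>x. R0B x + c * sl x + d * sr x - P x) M"
    "R0B 0 = 0" "R0B l = 0" "sl 0 = 1" "sl l = 0" "sr 0 = 0" "sr l = 1"
    by (rule combination_flux_system)
  have "v 0 + P 0 = R0B 0 + c * sl 0 + d * sr 0" "v l + P l = R0B l + c * sl l + d * sr l"
    by (rule eq, use l_pos in simp)+
  then show "v 0 = c" "v l = d" unfolding flux_part(2,3) M(2-7) by simp_all
qed

text \<open>The decomposition is differentiated at an end. There \<open>P\<close> vanishes, so its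
  slope is its flux over \<open>\<eta>\<close>, and the two parts of this flux yield the entries of
  \<open>V_int\<close> and \<open>V_bdry\<close> with their factor 3.\<close>

lemma decomposition_deriv_trace:
  assumes x: "x \<in> {0, l}"
  shows "c * D l sl x + d * D l sr x + 3 / (\<eta> x)\<^sup>2 * f x = 3 * r x - D l R0B x + v' x"
proof -
  have x': "x \<in> {0..l}" using x l_pos by auto
  have D: "deriv_on R0B (D l R0B x) x" "deriv_on sl (D l sl x) x" "deriv_on sr (D l sr x) x"
    by (rule combination_flux_system[of c d], use x' in simp)+
  have P0: "P x = 0" using x flux_part(2,3) by auto
  have "deriv_on P ((3 * \<eta> x * (r x - 1 / (\<eta> x)\<^sup>2 * f x) + \<beta> x * P x / 2) / \<eta> x) x"
    by (rule flux_system_u[OF flux_part(1) x'])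
  then have dP: "deriv_on P (3 * (r x - 1 / (\<eta> x)\<^sup>2 * f x)) x"
    unfolding P0 using eta_nz[OF x'] by simp
  have d1: "deriv_on (\<lambda>x. v x + P x) (v' x + 3 * (r x - 1 / (\<eta> x)\<^sup>2 * f x)) x"
    by (rule DERIV_add[OF dv[OF x'] dP])
  have "deriv_on (\<lambda>x. R0B x + c * sl x + d * sr x)
      (D l R0B x + c * D l sl x + d * D l sr x) x"
    by (intro DERIV_add DERIV_cmult D)
  then have d2: "deriv_on (\<lambda>x. v x + P x) (D l R0B x + c * D l sl x + d * D l sr x) x"
    using deriv_cong_on[of "{0..l}" "\<lambda>x. v x + P x", OF eq x'] by simp
  have "v' x + 3 * (r x - 1 / (\<eta> x)\<^sup>2 * f x) = D l R0B x + c * D l sl x + d * D l sr x"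
    using D_eqI[OF l_pos x' d1] D_eqI[OF l_pos x' d2] by simp
  then show ?thesis by (simp add: algebra_simps)
qed

end

end

end

section \<open>Dependence on time\<close>

lemma cont_slice:
  assumes "cont T l u"
  shows "t \<in> {0..T} \<Longrightarrow> continuous_on {0..l} (u t)"
    and "x \<in> {0..l} \<Longrightarrow> continuous_on {0..T} (\<lambda>t. u t x)"
proof -
  have c: "continuous_on ({0..T} \<times> {0..l}) (\<lambda>(t, x). u t x)" using assms unfolding cont_def .
  show "continuous_on {0..l} (u t)" if "t \<in> {0..T}"
  proof -
    have "continuous_on {0..l} (Pair t)" by (intro continuous_intros)
    from continuous_on_compose2[OF c this] show ?thesis using that by fastforce
  qed
  show "continuous_on {0..T} (\<lambda>t. u t x)" if "x \<in> {0..l}"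
  proof -
    have "continuous_on {0..T} (\<lambda>t. (t, x))" by (intro continuous_intros)
    from continuous_on_compose2[OF c this] show ?thesis using that by fastforce
  qed
qed

lemma cont_dt_deriv:
  assumes "cont_dt T l u" "t \<in> {0..T}" "x \<in> {0..l}"
  shows "((\<lambda>s. u s x) has_real_derivative dt T u t x) (at t within {0..T})"
  using assms has_derivative_D[of "\<lambda>s. u s x" T t] unfolding cont_dt_def dt_def by blast

lemma cont_dx_deriv:
  assumes "cont_dx T l u" "t \<in> {0..T}" "x \<in> {0..l}"
  shows "(u t has_real_derivative dx l u t x) (at x within {0..l})"
  using assms has_derivative_D[of "u t" l x] unfolding cont_dx_def dx_def by blast

text \<open>Regularity provides the derivative of \<open>dt T q\<close> in space but not that of
  \<open>dx l q\<close> in time. Writing \<open>q\<close> as its initial value plus the time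
  integral of \<open>dt T q\<close>, and differentiating under the integral, gives the
  latter.\<close>

lemma mixed_partials:
  assumes l: "0 < l" and qt: "cont_dt T l q" and qx: "cont_dx T l q" and qtx: "cont_dx T l (dt T q)"
    and t: "t \<in> {0..T}" and x: "x \<in> {0..l}"
  shows "((\<lambda>s. dx l q s x) has_real_derivative dx l (dt T q) t x) (at t within {0..T})"
proof -
  have c_qt: "cont T l (dt T q)" using qt unfolding cont_dt_def by blast
  have c_qtx: "cont T l (dx l (dt T q))" using qtx unfolding cont_dx_def by blast
  have q: "q s y = q 0 y + integral {0..s} (\<lambda>\<tau>. dt T q \<tau> y)" if s: "s \<in> {0..T}" and y: "y \<in> {0..l}" for s y
  proof -
    have "((\<lambda>\<tau>. dt T q \<tau> y) has_integral (q s y - q 0 y)) {0..s}"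
    proof (rule fundamental_theorem_of_calculus)
      fix \<tau> assume \<tau>: "\<tau> \<in> {0..s}"
      then have "\<tau> \<in> {0..T}" using s by auto
      from DERIV_subset[OF cont_dt_deriv[OF qt this y], of "{0..s}"]
      show "((\<lambda>s. q s y) has_vector_derivative dt T q \<tau> y) (at \<tau> within {0..s})"
        using s unfolding has_real_derivative_iff_has_vector_derivative by auto
    qed (use s in auto)
    from integral_unique[OF this] show ?thesis by simp
  qed
  have d: "dx l q s x = dx l q 0 x + integral {0..s} (\<lambda>\<tau>. dx l (dt T q) \<tau> x)" if s: "s \<in> {0..T}" for s
  proof -
    have zero: "0 \<in> {0..T}" using t by auto
    have "((\<lambda>y. integral (cbox 0 s) (\<lambda>\<tau>. dt T q \<tau> y)) has_field_derivative
        integral (cbox 0 s) (\<lambda>\<tau>. dx l (dt T q) \<tau> x)) (at x within {0..l})"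
    proof (rule leibniz_rule_field_derivative[OF _ _ _ x])
      fix y \<tau> assume "y \<in> {0..l}" "\<tau> \<in> cbox 0 s"
      then show "(dt T q \<tau> has_field_derivative dx l (dt T q) \<tau> y) (at y within {0..l})"
        using s by (intro cont_dx_deriv[OF qtx]) auto
    next
      fix y assume "y \<in> {0..l}"
      then show "(\<lambda>\<tau>. dt T q \<tau> y) integrable_on cbox 0 s"
        using s continuous_on_subset[OF cont_slice(2)[OF c_qt], of y "{0..s}"]
        by (auto intro: integrable_continuous_real)
    next
      have "continuous_on ({0..T} \<times> {0..l}) (\<lambda>(t, x). dx l (dt T q) t x)"
        using c_qtx unfolding cont_def .
      moreover have "continuous_on ({0..l} \<times> cbox 0 s) (\<lambda>z. (snd z, fst z))"
        by (intro continuous_intros)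
      ultimately have "continuous_on ({0..l} \<times> cbox 0 s)
          (\<lambda>z. case (snd z, fst z) of (t, x) \<Rightarrow> dx l (dt T q) t x)"
        by (rule continuous_on_compose2) (use s in auto)
      then show "continuous_on ({0..l} \<times> cbox 0 s) (\<lambda>(y, \<tau>). dx l (dt T q) \<tau> y)"
        by (simp add: case_prod_beta)
    qed simp
    then have "((\<lambda>y. q 0 y + integral {0..s} (\<lambda>\<tau>. dt T q \<tau> y)) has_real_derivative
        dx l q 0 x + integral {0..s} (\<lambda>\<tau>. dx l (dt T q) \<tau> x)) (at x within {0..l})"
      using cont_dx_deriv[OF qx zero x] by (intro DERIV_add) simp_all
    then have "(q s has_real_derivative
        dx l q 0 x + integral {0..s} (\<lambda>\<tau>. dx l (dt T q) \<tau> x)) (at x within {0..l})"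
      using deriv_cong_on[of "{0..l}" "q s", OF q[OF s] x] by simp
    then show ?thesis using D_eqI[OF l x] unfolding dx_def by blast
  qed
  have "((\<lambda>s. integral {0..s} (\<lambda>\<tau>. dx l (dt T q) \<tau> x)) has_real_derivative dx l (dt T q) t x) (at t within {0..T})"
    using integral_has_vector_derivative[OF cont_slice(2)[OF c_qtx x] t]
    unfolding has_real_derivative_iff_has_vector_derivative .
  from DERIV_add[OF DERIV_const this]
  have "((\<lambda>s. dx l q 0 x + integral {0..s} (\<lambda>\<tau>. dx l (dt T q) \<tau> x)) has_real_derivative
      0 + dx l (dt T q) t x) (at t within {0..T})" .
  then show ?thesis
    using deriv_cong_on[of "{0..T}" "\<lambda>s. dx l q s x", OF d t] by simp
qed

section \<open>Recovering the boundary data from the boundary ODE\<close>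

text \<open>Both parts of the difference contain the factor \<open>z - g\<close>. The depth is
  bounded below at \<open>z\<close> only; closeness within \<open>\<delta> / 2\<close> keeps the
  depth at \<open>g\<close> above \<open>\<delta> / 2\<close> in absolute value.\<close>

lemma f_NSW_locally_lipschitz:
  assumes \<delta>: "0 < \<delta>" "\<delta> \<le> \<bar>depth h0 b x z\<bar>" and R: "\<bar>depth h0 b x z\<bar> \<le> R" and p: "\<bar>p\<bar> \<le> P"
    and near: "\<bar>z - g\<bar> \<le> \<delta> / 2"
  shows "\<bar>f_NSW grav h0 b x z p - f_NSW grav h0 b x g p\<bar>
    \<le> (\<bar>grav\<bar> * (2 * R + \<delta>) + P\<^sup>2 * (2 / \<delta>\<^sup>2)) * \<bar>z - g\<bar>"
proof -
  define d where "d = depth h0 b x z"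
  define e where "e = z - g"
  have dg: "depth h0 b x g = d - e" unfolding d_def e_def depth_def by simp
  have e: "\<bar>e\<bar> \<le> \<delta> / 2" and d: "\<delta> \<le> \<bar>d\<bar>" "\<bar>d\<bar> \<le> R" using assms unfolding e_def d_def by auto
  have de: "\<delta> / 2 \<le> \<bar>d - e\<bar>" using e d(1) by linarith
  have nz: "d \<noteq> 0" "d - e \<noteq> 0" using d de \<delta> by auto
  have "f_NSW grav h0 b x z p - f_NSW grav h0 b x g p
      = grav / 2 * (2 * d - e) * e + - (p\<^sup>2 * (1 / (d * (d - e))) * e)"
    unfolding f_NSW_def dg d_def[symmetric] using nz
    by (simp add: field_simps power2_eq_square)
  also have "\<bar>\<dots>\<bar> \<le> \<bar>grav / 2 * (2 * d - e) * e\<bar> + \<bar>p\<^sup>2 * (1 / (d * (d - e))) * e\<bar>"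
    by (rule order_trans[OF abs_triangle_ineq]) simp
  also have "\<bar>grav / 2 * (2 * d - e) * e\<bar> \<le> \<bar>grav\<bar> * (2 * R + \<delta>) * \<bar>e\<bar>"
    unfolding abs_mult using e d \<delta> by (intro mult_right_mono mult_mono) auto
  also have "\<bar>p\<^sup>2 * (1 / (d * (d - e))) * e\<bar> \<le> P\<^sup>2 * (2 / \<delta>\<^sup>2) * \<bar>e\<bar>"
  proof -
    have "\<delta> * (\<delta> / 2) \<le> \<bar>d\<bar> * \<bar>d - e\<bar>" using d de \<delta> by (intro mult_mono) auto
    then have "1 / (\<bar>d\<bar> * \<bar>d - e\<bar>) \<le> 1 / (\<delta> * (\<delta> / 2))"
      using \<delta>(1) by (intro frac_le) auto
    also have "\<dots> = 2 / \<delta>\<^sup>2" by (simp add: power2_eq_square)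
    finally have "\<bar>1 / (d * (d - e))\<bar> \<le> 2 / \<delta>\<^sup>2" by (simp add: abs_mult)
    moreover have "\<bar>p\<^sup>2\<bar> \<le> P\<^sup>2" using power_mono[OF p, of 2] by simp
    ultimately show ?thesis unfolding abs_mult by (intro mult_right_mono mult_mono) auto
  qed
  finally show ?thesis unfolding e_def by (simp add: algebra_simps)
qed

text \<open>\<open>z - g\<close> solves a second order ODE with zero initial data whose right-hand
  side is Lipschitz only while \<open>z\<close> and \<open>g\<close> are close. This is why the
  uniqueness result asks for its bound only where the deviation is small.\<close>

lemma boundary_data_recovered:
  assumes dz: "\<And>t. t \<in> {0..T} \<Longrightarrow> (z has_real_derivative z1 t) (at t within {0..T})"
    and dz1: "\<And>t. t \<in> {0..T} \<Longrightarrow> (z1 has_real_derivative z2 t) (at t within {0..T})"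
    and dg: "\<And>t. t \<in> {0..T} \<Longrightarrow> (g has_real_derivative g1 t) (at t within {0..T})"
    and dg1: "\<And>t. t \<in> {0..T} \<Longrightarrow> (g1 has_real_derivative g2 t) (at t within {0..T})"
    and init: "z 0 = g 0" "z1 0 = g1 0"
    and cp: "continuous_on {0..T} p"
    and depth_nz: "\<And>t. t \<in> {0..T} \<Longrightarrow> depth h0 b x (z t) \<noteq> 0"
    and eq: "\<And>t. t \<in> {0..T} \<Longrightarrow>
      g2 t - z2 t = k * f_NSW grav h0 b x (z t) (p t) - k * f_NSW grav h0 b x (g t) (p t)"
    and t: "t \<in> {0..T}"
  shows "z t = g t"
proof -
  have ne: "{0..T} \<noteq> {}" using t by auto
  have cd: "continuous_on {0..T} (\<lambda>t. \<bar>depth h0 b x (z t)\<bar>)"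
    unfolding depth_def by (intro continuous_intros continuous_on_of_deriv[OF dz])
  obtain s where s: "s \<in> {0..T}" "\<And>t. t \<in> {0..T} \<Longrightarrow> \<bar>depth h0 b x (z s)\<bar> \<le> \<bar>depth h0 b x (z t)\<bar>"
    using continuous_attains_inf[OF compact_Icc ne cd] by blast
  obtain s' where s': "s' \<in> {0..T}" "\<And>t. t \<in> {0..T} \<Longrightarrow> \<bar>depth h0 b x (z t)\<bar> \<le> \<bar>depth h0 b x (z s')\<bar>"
    using continuous_attains_sup[OF compact_Icc ne cd] by blast
  obtain s'' where s'': "\<And>t. t \<in> {0..T} \<Longrightarrow> \<bar>p t\<bar> \<le> \<bar>p s''\<bar>"
    using continuous_attains_sup[OF compact_Icc ne continuous_on_rabs[OF cp]] by blast
  \<comment> \<open>The minimum over time of the depth in absolute value, positive by compactness;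
    half of it is the admissible deviation.\<close>
  define \<delta> where "\<delta> = \<bar>depth h0 b x (z s)\<bar>"
  have \<delta>: "0 < \<delta>" unfolding \<delta>_def using depth_nz[OF s(1)] by simp
  define C where "C = \<bar>k\<bar> * (\<bar>grav\<bar> * (2 * \<bar>depth h0 b x (z s')\<bar> + \<delta>) + \<bar>p s''\<bar>\<^sup>2 * (2 / \<delta>\<^sup>2))"
  have "z t - g t = 0"
  proof (rule second_order_local_uniqueness[where T=T and t=t and e="\<lambda>t. z t - g t" and \<epsilon>="\<delta> / 2" and C=C and ?e1.0="\<lambda>t. z1 t - g1 t"
        and ?e2.0="\<lambda>t. z2 t - g2 t"])
    fix t assume t: "t \<in> {0..T}" and small: "\<bar>z t - g t\<bar> \<le> \<delta> / 2"
    have "\<bar>z2 t - g2 t\<bar> = \<bar>k\<bar> * \<bar>f_NSW grav h0 b x (z t) (p t) - f_NSW grav h0 b x (g t) (p t)\<bar>"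
      using eq[OF t] by (metis abs_minus_commute abs_mult right_diff_distrib)
    also have "\<dots> \<le> \<bar>k\<bar> * ((\<bar>grav\<bar> * (2 * \<bar>depth h0 b x (z s')\<bar> + \<delta>) + \<bar>p s''\<bar>\<^sup>2 * (2 / \<delta>\<^sup>2)) * \<bar>z t - g t\<bar>)"
      using s(2)[OF t] s'(2)[OF t] s''[OF t] small \<delta>
      by (intro mult_left_mono f_NSW_locally_lipschitz) (auto simp: \<delta>_def)
    finally show "\<bar>z2 t - g2 t\<bar> \<le> C * \<bar>z t - g t\<bar>" unfolding C_def by (simp add: mult.assoc)
  qed (use init \<delta> t in \<open>auto intro!: DERIV_diff dz dz1 dg dg1\<close>)
  then show ?thesis by simp
qed

lemma boundary_ode_iff:
  "S_mat' l h0 b *v vector [c, d] + V_bdry l grav h0 b z0 p0 zl pl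
      = V_int l grav h0 b Z Q - vector [x, y] \<longleftrightarrow>
    c * D l (s_left l h0 b) 0 + d * D l (s_right l h0 b) 0 + 3 / (hb h0 b 0)\<^sup>2 * f_NSW grav h0 b 0 z0 p0
      = 3 * R1_flux l grav h0 b Z Q 0 - D l (R0 l h0 b (B_src l grav h0 b Z Q)) 0 - x \<and>
    c * D l (s_left l h0 b) l + d * D l (s_right l h0 b) l + 3 / (hb h0 b l)\<^sup>2 * f_NSW grav h0 b l zl pl
      = 3 * R1_flux l grav h0 b Z Q l - D l (R0 l h0 b (B_src l grav h0 b Z Q)) l - y"
  by (simp add: vec_eq_iff forall_2 matrix_vector_mult_def sum_2 S_mat'_def V_bdry_def V_int_def mult.commute)

section \<open>Consequences of regularity and of mass conservation\<close>

locale regular_couple = bottom +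
  fixes T grav :: real and \<zeta> q :: "real \<Rightarrow> real \<Rightarrow> real"
  assumes T_pos: "0 < T"
    and reg: "regular T l \<zeta> q"
    and depth_nz: "\<And>t x. t \<in> {0..T} \<Longrightarrow> x \<in> {0..l} \<Longrightarrow> depth h0 b x (\<zeta> t x) \<noteq> 0"
    and mass_int: "\<And>t x. t \<in> {0..T} \<Longrightarrow> x \<in> {0<..<l} \<Longrightarrow> dt T \<zeta> t x + dx l q t x = 0"
begin

lemma reg_facts:
  "cont_dt T l \<zeta>" "cont_dx T l \<zeta>" "cont_dt T l (dt T \<zeta>)" "cont_dt T l q" "cont_dx T l q"
  "cont_dx T l (dt T q)" "cont_dx T l (dx l (dt T q))"
  using reg unfolding regular_def by blast+

lemma profile_at:
  assumes t: "t \<in> {0..T}"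
  shows "profile l h0 b (\<zeta> t) (q t) (dx l \<zeta> t) (dx l q t)"
proof
  show "continuous_on {0..l} (dx l \<zeta> t)" "continuous_on {0..l} (dx l q t)"
    using reg_facts(2,5) t unfolding cont_dx_def by (auto intro: cont_slice(1))
qed (use t reg_facts depth_nz in \<open>auto intro!: cont_dx_deriv\<close>)

lemma qt_deriv:
  assumes t: "t \<in> {0..T}"
  shows "x \<in> {0..l} \<Longrightarrow> deriv_on (dt T q t) (dx l (dt T q) t x) x"
    and "x \<in> {0..l} \<Longrightarrow> deriv_on (dx l (dt T q) t) (dx l (dx l (dt T q)) t x) x"
    and "continuous_on {0..l} (dx l (dx l (dt T q)) t)"
proof -
  show "continuous_on {0..l} (dx l (dx l (dt T q)) t)"
    using reg_facts(7) t unfolding cont_dx_def by (auto intro: cont_slice(1))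
qed (use t reg_facts in \<open>auto intro!: cont_dx_deriv\<close>)

lemma mass:
  assumes t: "t \<in> {0..T}" and x: "x \<in> {0..l}"
  shows "dx l q t x = - dt T \<zeta> t x"
proof (rule eq_on_closed_interval[OF l_pos _ _ _ x])
  show "continuous_on {0..l} (dx l q t)" "continuous_on {0..l} (\<lambda>x. - dt T \<zeta> t x)"
    using reg_facts(1,5) t unfolding cont_dx_def cont_dt_def
    by (auto intro!: cont_slice(1) continuous_on_minus)
  show "dx l q t x = - dt T \<zeta> t x" if "x \<in> {0<..<l}" for x
    using mass_int[OF t that] by simp
qed

text \<open>The mass equation holds up to the ends and may be differentiated in time once the mixed
  derivatives commute. This is how second time derivatives of the surface enter the boundary
  ODE.\<close>

lemma qtx_eq:
  assumes t: "t \<in> {0..T}" and x: "x \<in> {0..l}"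
  shows "dx l (dt T q) t x = - dt T (dt T \<zeta>) t x"
proof -
  have "((\<lambda>s. - dt T \<zeta> s x) has_real_derivative dx l (dt T q) t x) (at t within {0..T})"
    using mixed_partials[OF l_pos reg_facts(4,5,6) t x]
      deriv_cong_on[of "{0..T}" "\<lambda>s. dx l q s x" "\<lambda>s. - dt T \<zeta> s x", OF mass[OF _ x] t] by simp
  from D_eqI[OF T_pos t this] D_eqI[OF T_pos t DERIV_minus[OF cont_dt_deriv[OF reg_facts(3) t x]]]
  show ?thesis by simp
qed

text \<open>The second claim is written with the traces of \<open>\<zeta>\<close> and not with the
  data, so that it serves both directions: data are substituted in one, and compared with the traces
  in the other.\<close>

lemma momentum_imp_nonlocal:
  assumes eq: "\<And>x. x \<in> {0<..<l} \<Longrightarrow> one_plus_hbTb l h0 b (dt T q t) x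
      + D l (\<lambda>y. f_NSW grav h0 b y (\<zeta> t y) (q t y)) x = - grav * depth h0 b x (\<zeta> t x) * D l b x"
    and t: "t \<in> {0..T}"
  shows "\<And>x. x \<in> {0..l} \<Longrightarrow> dt T q t x
      + sqrt 3 * (hb h0 b x / alphab l b x) * hbS_adj l h0 b (R1_flux l grav h0 b (\<zeta> t) (q t)) x
    = R0 l h0 b (B_src l grav h0 b (\<zeta> t) (q t)) x
      + dt T q t 0 * s_left l h0 b x + dt T q t l * s_right l h0 b x"
    and "\<And>x. x \<in> {0, l} \<Longrightarrow> dt T q t 0 * D l (s_left l h0 b) x + dt T q t l * D l (s_right l h0 b) x
      + 3 / (hb h0 b x)\<^sup>2 * f_NSW grav h0 b x (\<zeta> t x) (q t x)
    = 3 * R1_flux l grav h0 b (\<zeta> t) (q t) x - D l (R0 l h0 b (B_src l grav h0 b (\<zeta> t) (q t))) x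
      - dt T (dt T \<zeta>) t x"
proof -
  interpret p: profile l h0 b grav "\<zeta> t" "q t" "dx l \<zeta> t" "dx l q t"
    by (rule profile_at[OF t])
  show dec: "dt T q t x
      + sqrt 3 * (hb h0 b x / alphab l b x) * hbS_adj l h0 b (R1_flux l grav h0 b (\<zeta> t) (q t)) x
    = R0 l h0 b (B_src l grav h0 b (\<zeta> t) (q t)) x
      + dt T q t 0 * s_left l h0 b x + dt T q t l * s_right l h0 b x" if "x \<in> {0..l}" for x
    by (rule p.momentum_imp_decomposition[OF qt_deriv[OF t] eq]) (use that in simp_all)
  show "dt T q t 0 * D l (s_left l h0 b) x + dt T q t l * D l (s_right l h0 b) x
      + 3 / (hb h0 b x)\<^sup>2 * f_NSW grav h0 b x (\<zeta> t x) (q t x)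
    = 3 * R1_flux l grav h0 b (\<zeta> t) (q t) x - D l (R0 l h0 b (B_src l grav h0 b (\<zeta> t) (q t))) x
      - dt T (dt T \<zeta>) t x" if x: "x \<in> {0, l}" for x
  proof -
    have x': "x \<in> {0..l}" using x l_pos by auto
    have "dt T q t 0 * D l (s_left l h0 b) x + dt T q t l * D l (s_right l h0 b) x
        + 3 / (hb h0 b x)\<^sup>2 * f_NSW grav h0 b x (\<zeta> t x) (q t x)
      = 3 * R1_flux l grav h0 b (\<zeta> t) (q t) x - D l (R0 l h0 b (B_src l grav h0 b (\<zeta> t) (q t))) x
        + dx l (dt T q) t x"
      by (rule p.decomposition_deriv_trace[OF qt_deriv[OF t] dec]) (use x in simp_all)
    then show ?thesis unfolding qtx_eq[OF t x'] by simp
  qed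
qed

text \<open>The coefficients \<open>c\<close> and \<open>d\<close> are arbitrary here; evaluating
  the decomposition at the ends identifies them with the traces of \<open>dt T q\<close>.\<close>

lemma nonlocal_imp_momentum:
  assumes eq: "\<And>x. x \<in> {0<..<l} \<Longrightarrow> dt T q t x
      + sqrt 3 * (hb h0 b x / alphab l b x) * hbS_adj l h0 b (R1_flux l grav h0 b (\<zeta> t) (q t)) x
    = R0 l h0 b (B_src l grav h0 b (\<zeta> t) (q t)) x + c * s_left l h0 b x + d * s_right l h0 b x"
    and t: "t \<in> {0..T}"
  shows "\<And>x. x \<in> {0..l} \<Longrightarrow> one_plus_hbTb l h0 b (dt T q t) x
      + D l (\<lambda>y. f_NSW grav h0 b y (\<zeta> t y) (q t y)) x = - grav * depth h0 b x (\<zeta> t x) * D l b x"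
    and "dt T q t 0 = c" "dt T q t l = d"
proof -
  interpret p: profile l h0 b grav "\<zeta> t" "q t" "dx l \<zeta> t" "dx l q t"
    by (rule profile_at[OF t])
  have dec: "dt T q t x
      + sqrt 3 * (hb h0 b x / alphab l b x) * hbS_adj l h0 b (R1_flux l grav h0 b (\<zeta> t) (q t)) x
    = R0 l h0 b (B_src l grav h0 b (\<zeta> t) (q t)) x + c * s_left l h0 b x + d * s_right l h0 b x"
    if "x \<in> {0..l}" for x
    by (rule p.decomposition_on_closed[OF qt_deriv[OF t] eq]) (use that in simp_all)
  show "one_plus_hbTb l h0 b (dt T q t) x
      + D l (\<lambda>y. f_NSW grav h0 b y (\<zeta> t y) (q t y)) x = - grav * depth h0 b x (\<zeta> t x) * D l b x"
    if "x \<in> {0..l}" for x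
    by (rule p.decomposition_imp_momentum[OF qt_deriv[OF t] dec]) (use that in simp_all)
  show "dt T q t 0 = c" "dt T q t l = d"
    by (rule p.decomposition_trace[OF qt_deriv[OF t] dec]; simp)+
qed

end

theorem proposition2p8:
  fixes l h0 grav T :: real
    and b \<zeta>in qin g0 gl :: "real \<Rightarrow> real"
    and \<zeta> q :: "real \<Rightarrow> real \<Rightarrow> real"
  assumes pos: "l > 0" "h0 > 0" "grav > 0" "T > 0"
    and b_smooth: "smooth_upto l b"
    and hb_pos: "(INF x\<in>{0<..<l}. hb h0 b x) > 0"
    and coercive: "(INF x\<in>{0<..<l}. 1 + 1/4 * (D l b x)\<^sup>2 + 1/6 * hb h0 b x * D l (D l b) x) > 0"
    and g0_reg: "g0 differentiable_on {0..T}" "D T g0 differentiable_on {0..T}"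
    and gl_reg: "gl differentiable_on {0..T}" "D T gl differentiable_on {0..T}"
    and compat_0: "\<zeta>in 0 = g0 0" "(qin has_real_derivative - D T g0 0) (at 0 within {0..l})"
    and compat_l: "\<zeta>in l = gl 0" "(qin has_real_derivative - D T gl 0) (at l within {0..l})"
  shows
    "(regular T l \<zeta> q \<and>
      (\<forall>t\<in>{0..T}. \<forall>x\<in>{0..l}. depth h0 b x (\<zeta> t x) \<noteq> 0) \<and>
      (\<forall>t\<in>{0..T}. \<forall>x\<in>{0<..<l}.
         dt T \<zeta> t x + dx l q t x = 0 \<and>
         one_plus_hbTb l h0 b (dt T q t) x + D l (\<lambda>y. f_NSW grav h0 b y (\<zeta> t y) (q t y)) x
           = - grav * depth h0 b x (\<zeta> t x) * D l b x) \<and>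
      (\<forall>t\<in>{0..T}. \<zeta> t 0 = g0 t \<and> \<zeta> t l = gl t) \<and>
      (\<forall>x\<in>{0..l}. \<zeta> 0 x = \<zeta>in x \<and> q 0 x = qin x))
     \<longleftrightarrow>
     (\<exists>q0 ql :: real \<Rightarrow> real.
      regular T l \<zeta> q \<and>
      (\<forall>t\<in>{0..T}. \<forall>x\<in>{0..l}. depth h0 b x (\<zeta> t x) \<noteq> 0) \<and>
      (\<forall>t\<in>{0..T}. \<forall>x\<in>{0<..<l}.
         dt T \<zeta> t x + dx l q t x = 0 \<and>
         dt T q t x
           + sqrt 3 * (hb h0 b x / alphab l b x)
             * hbS_adj l h0 b (R1_flux l grav h0 b (\<zeta> t) (q t)) x
           = R0 l h0 b (B_src l grav h0 b (\<zeta> t) (q t)) x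
             + D T q0 t * s_left l h0 b x + D T ql t * s_right l h0 b x) \<and>
      (\<forall>x\<in>{0..l}. \<zeta> 0 x = \<zeta>in x \<and> q 0 x = qin x) \<and>
      q0 differentiable_on {0..T} \<and> ql differentiable_on {0..T} \<and>
      (\<forall>t\<in>{0..T}.
         S_mat' l h0 b *v vector [D T q0 t, D T ql t] + V_bdry l grav h0 b (g0 t) (q0 t) (gl t) (ql t)
           = V_int l grav h0 b (\<zeta> t) (q t) - vector [D T (D T g0) t, D T (D T gl) t]) \<and>
      q0 0 = qin 0 \<and> ql 0 = qin l)"
  (is "?L \<longleftrightarrow> ?R")
proof
  interpret bottom l h0 b by (rule bottom_intro[OF pos(1) b_smooth hb_pos])
  have ends: "0 \<in> {0..l}" "l \<in> {0..l}" "0 \<in> {0..T}" using pos by auto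
  assume L: ?L
  interpret regular_couple l h0 b T grav \<zeta> q
    by unfold_locales (use L pos in auto)
  have mom: "one_plus_hbTb l h0 b (dt T q t) x + D l (\<lambda>y. f_NSW grav h0 b y (\<zeta> t y) (q t y)) x
      = - grav * depth h0 b x (\<zeta> t x) * D l b x" if "t \<in> {0..T}" "x \<in> {0<..<l}" for t x
    using L that by blast
  have tr: "\<zeta> t 0 = g0 t" "\<zeta> t l = gl t" if "t \<in> {0..T}" for t using L that by blast+
  \<comment> \<open>The boundary conditions hold on the whole time interval and may thus be
    differentiated in time, here once and then a second time.\<close>
  have Dt: "dt T \<zeta> t 0 = D T g0 t" "dt T \<zeta> t l = D T gl t" if "t \<in> {0..T}" for t
    unfolding dt_def by (rule D_cong[OF _ that], rule tr, assumption)+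
  have Dtt: "dt T (dt T \<zeta>) t 0 = D T (D T g0) t" "dt T (dt T \<zeta>) t l = D T (D T gl) t"
    if "t \<in> {0..T}" for t
    unfolding dt_def[of T "dt T \<zeta>"] by (rule D_cong[OF _ that], rule Dt, assumption)+
  have diff: "(\<lambda>s. q s x) differentiable_on {0..T}" if "x \<in> {0..l}" for x
    using reg_facts(4) that unfolding cont_dt_def by blast
  have Dq: "D T (\<lambda>s. q s x) t = dt T q t x" for x t unfolding dt_def ..
  show ?R
  \<comment> \<open>The boundary unknowns are the traces of \<open>q\<close> itself.\<close>
  proof (rule exI[of _ "\<lambda>s. q s 0"], rule exI[of _ "\<lambda>s. q s l"], intro conjI ballI)
    show "regular T l \<zeta> q" by (rule reg)
    show "(\<lambda>s. q s 0) differentiable_on {0..T}" "(\<lambda>s. q s l) differentiable_on {0..T}"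
      by (rule diff, rule ends)+
    show "q 0 0 = qin 0" "q 0 l = qin l" using L ends by blast+
    fix t assume t: "t \<in> {0..T}"
    show "depth h0 b x (\<zeta> t x) \<noteq> 0" if "x \<in> {0..l}" for x by (rule depth_nz[OF t that])
    show "dt T \<zeta> t x + dx l q t x = 0" if "x \<in> {0<..<l}" for x by (rule mass_int[OF t that])
    show "dt T q t x + sqrt 3 * (hb h0 b x / alphab l b x)
        * hbS_adj l h0 b (R1_flux l grav h0 b (\<zeta> t) (q t)) x
      = R0 l h0 b (B_src l grav h0 b (\<zeta> t) (q t)) x
        + D T (\<lambda>s. q s 0) t * s_left l h0 b x + D T (\<lambda>s. q s l) t * s_right l h0 b x"
      if "x \<in> {0<..<l}" for x
      unfolding Dq by (rule momentum_imp_nonlocal(1)[OF mom[OF t] t]) (use that in auto)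
    show "S_mat' l h0 b *v vector [D T (\<lambda>s. q s 0) t, D T (\<lambda>s. q s l) t]
        + V_bdry l grav h0 b (g0 t) (q t 0) (gl t) (q t l)
      = V_int l grav h0 b (\<zeta> t) (q t) - vector [D T (D T g0) t, D T (D T gl) t]"
      unfolding boundary_ode_iff Dq
      using momentum_imp_nonlocal(2)[OF mom[OF t] t, of 0] momentum_imp_nonlocal(2)[OF mom[OF t] t, of l]
        tr[OF t] Dtt[OF t] by simp
  next
    fix x assume "x \<in> {0..l}"
    then show "\<zeta> 0 x = \<zeta>in x" "q 0 x = qin x" using L by blast+
  qed
next
  interpret bottom l h0 b by (rule bottom_intro[OF pos(1) b_smooth hb_pos])
  have ends: "0 \<in> {0..l}" "l \<in> {0..l}" "0 \<in> {0..T}" using pos by auto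
  assume ?R
  then obtain q0 ql where reg': "regular T l \<zeta> q"
    and depth': "\<forall>t\<in>{0..T}. \<forall>x\<in>{0..l}. depth h0 b x (\<zeta> t x) \<noteq> 0"
    and pde: "\<forall>t\<in>{0..T}. \<forall>x\<in>{0<..<l}.
         dt T \<zeta> t x + dx l q t x = 0 \<and>
         dt T q t x
           + sqrt 3 * (hb h0 b x / alphab l b x)
             * hbS_adj l h0 b (R1_flux l grav h0 b (\<zeta> t) (q t)) x
           = R0 l h0 b (B_src l grav h0 b (\<zeta> t) (q t)) x
             + D T q0 t * s_left l h0 b x + D T ql t * s_right l h0 b x"
    and init: "\<forall>x\<in>{0..l}. \<zeta> 0 x = \<zeta>in x \<and> q 0 x = qin x"
    and q_diff: "q0 differentiable_on {0..T}" "ql differentiable_on {0..T}"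
    and ode: "\<forall>t\<in>{0..T}.
         S_mat' l h0 b *v vector [D T q0 t, D T ql t] + V_bdry l grav h0 b (g0 t) (q0 t) (gl t) (ql t)
           = V_int l grav h0 b (\<zeta> t) (q t) - vector [D T (D T g0) t, D T (D T gl) t]"
    and q_init: "q0 0 = qin 0" "ql 0 = qin l"
    by (elim exE conjE)
  interpret regular_couple l h0 b T grav \<zeta> q
    by unfold_locales (use reg' depth' pde pos in auto)
  have nonlocal: "dt T q t x + sqrt 3 * (hb h0 b x / alphab l b x)
        * hbS_adj l h0 b (R1_flux l grav h0 b (\<zeta> t) (q t)) x
      = R0 l h0 b (B_src l grav h0 b (\<zeta> t) (q t)) x
        + D T q0 t * s_left l h0 b x + D T ql t * s_right l h0 b x"
    if "t \<in> {0..T}" "x \<in> {0<..<l}" for t x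
    using pde that by blast
  note mom = nonlocal_imp_momentum(1)[OF nonlocal]
  have mom': "one_plus_hbTb l h0 b (dt T q t) x + D l (\<lambda>y. f_NSW grav h0 b y (\<zeta> t y) (q t y)) x
      = - grav * depth h0 b x (\<zeta> t x) * D l b x" if "t \<in> {0..T}" "x \<in> {0<..<l}" for t x
    by (rule mom[OF that(1) _ that(1)]) (use that(2) in auto)
  have trace: "dt T q t 0 = D T q0 t" "dt T q t l = D T ql t" if t: "t \<in> {0..T}" for t
    by (rule nonlocal_imp_momentum(2,3)[OF nonlocal[OF t] t], assumption)+
  \<comment> \<open>Equal time derivatives and equal initial values identify the solutions of the
    ODE with the traces of \<open>q\<close>.\<close>
  have q_trace: "p t = q t x"
    if t: "t \<in> {0..T}" and p: "p differentiable_on {0..T}" "p 0 = qin x" and x: "x \<in> {0..l}"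
      and Dp: "\<And>t. t \<in> {0..T} \<Longrightarrow> dt T q t x = D T p t" for p x t
  proof -
    have "p t - q t x = p 0 - q 0 x"
    proof (rule const_of_zero_deriv[where f="\<lambda>s. p s - q s x", OF pos(4) _ t])
      fix s assume s: "s \<in> {0..T}"
      show "((\<lambda>t. p t - q t x) has_real_derivative 0) (at s within {0..T})"
        using DERIV_diff[OF has_derivative_D[OF p(1) s] cont_dt_deriv[OF reg_facts(4) s x]] Dp[OF s]
        by simp
    qed
    then show ?thesis using p(2) init x by simp
  qed
  have q0: "q0 t = q t 0" if "t \<in> {0..T}" for t
    by (rule q_trace[OF that q_diff(1) q_init(1) ends(1) trace(1)])
  have ql: "ql t = q t l" if "t \<in> {0..T}" for t
    by (rule q_trace[OF that q_diff(2) q_init(2) ends(2) trace(2)])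
  have c_q: "continuous_on {0..T} (\<lambda>t. q t x)" if "x \<in> {0..l}" for x
    by (rule continuous_on_of_deriv[OF cont_dt_deriv[OF reg_facts(4) _ that]])
  \<comment> \<open>Mass conservation at time 0 turns the second compatibility condition into
    equality of the first time derivatives of \<open>\<zeta>\<close> and of the datum.\<close>
  have init_t: "dt T \<zeta> 0 x = d" if x: "x \<in> {0..l}"
    and d: "(qin has_real_derivative - d) (at x within {0..l})" for x d
  proof -
    have "(q 0 has_real_derivative - d) (at x within {0..l})"
      using deriv_cong_on[of "{0..l}" "q 0" qin x "- d"] init x d by blast
    from D_eqI[OF pos(1) x this] mass[OF ends(3) x] show ?thesis by (simp add: dx_def)
  qed
  \<comment> \<open>The assumed ODE and the relation from \<open>momentum_imp_nonlocal\<close> share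
    the layer terms and the interior terms. Subtracting them leaves only the second time derivatives
    and the values of \<open>f_NSW\<close> at the datum and at the trace.\<close>
  have recovered: "\<zeta> t x = g t"
    if t: "t \<in> {0..T}" and x: "x \<in> {0, l}"
      and g: "g differentiable_on {0..T}" "D T g differentiable_on {0..T}"
      and g_in: "\<zeta>in x = g 0" "(qin has_real_derivative - D T g 0) (at x within {0..l})"
      and g_ode: "\<And>t. t \<in> {0..T} \<Longrightarrow>
        D T q0 t * D l (s_left l h0 b) x + D T ql t * D l (s_right l h0 b) x
          + 3 / (hb h0 b x)\<^sup>2 * f_NSW grav h0 b x (g t) (q t x)
        = 3 * R1_flux l grav h0 b (\<zeta> t) (q t) x
          - D l (R0 l h0 b (B_src l grav h0 b (\<zeta> t) (q t))) x - D T (D T g) t" for g t x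
  proof -
    have x': "x \<in> {0..l}" using x ends by auto
    show ?thesis
    proof (rule boundary_data_recovered[where T=T and ?g1.0="D T g" and ?g2.0="D T (D T g)"
          and ?z1.0="\<lambda>t. dt T \<zeta> t x" and ?z2.0="\<lambda>t. dt T (dt T \<zeta>) t x" and p="\<lambda>t. q t x"
          and k="3 / (hb h0 b x)\<^sup>2" and z="\<lambda>t. \<zeta> t x" and g=g and x=x])
      fix t assume t: "t \<in> {0..T}"
      show "D T (D T g) t - dt T (dt T \<zeta>) t x
        = 3 / (hb h0 b x)\<^sup>2 * f_NSW grav h0 b x (\<zeta> t x) (q t x)
          - 3 / (hb h0 b x)\<^sup>2 * f_NSW grav h0 b x (g t) (q t x)"
        using g_ode[OF t] momentum_imp_nonlocal(2)[OF mom'[OF t] t x] trace[OF t] by simp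
    qed (use t x' g_in init init_t[OF x' g_in(2)] in
      \<open>auto intro: cont_dt_deriv reg_facts has_derivative_D[OF g(1)] has_derivative_D[OF g(2)] c_q simp: depth_nz\<close>)
  qed
  have ode': "D T q0 t * D l (s_left l h0 b) 0 + D T ql t * D l (s_right l h0 b) 0
        + 3 / (hb h0 b 0)\<^sup>2 * f_NSW grav h0 b 0 (g0 t) (q t 0)
      = 3 * R1_flux l grav h0 b (\<zeta> t) (q t) 0
        - D l (R0 l h0 b (B_src l grav h0 b (\<zeta> t) (q t))) 0 - D T (D T g0) t"
    "D T q0 t * D l (s_left l h0 b) l + D T ql t * D l (s_right l h0 b) l
        + 3 / (hb h0 b l)\<^sup>2 * f_NSW grav h0 b l (gl t) (q t l)
      = 3 * R1_flux l grav h0 b (\<zeta> t) (q t) l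
        - D l (R0 l h0 b (B_src l grav h0 b (\<zeta> t) (q t))) l - D T (D T gl) t"
    if t: "t \<in> {0..T}" for t
    using ode[rule_format, OF t] unfolding boundary_ode_iff q0[OF t] ql[OF t] by blast+
  have "\<zeta> t 0 = g0 t" "\<zeta> t l = gl t" if "t \<in> {0..T}" for t
    by (rule recovered[OF that _ g0_reg compat_0 ode'(1)], simp, assumption)
       (rule recovered[OF that _ gl_reg compat_l ode'(2)], simp, assumption)
  then show ?L
    using reg' depth' mass_int mom' init by blast
qed

end
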